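(* Suppose that the model parameters $\boldsymbol{\beta}$, $\mu_i$ and $\sigma_{i}$ are known. Under Assumption 1, \begin{align*} CD &= \sqrt{\frac{2}{TN(N-1)}}\sum_{i=2}^{N} \sum_{j=1}^{i-1}\sum_{t=1}^{T}\varepsilon_{i,t}\varepsilon_{j,t}\left(\sigma_{i}^{-1}-\overline{\sigma^{-1}}\right)\left(\sigma_{j}^{-1}-\overline{\sigma^{-1}}\right) +\sqrt{T}\, \Xi + O_{P}(\sqrt{T}N^{-1}), \end{align*} where \begin{align*} \Xi &= \sqrt{\frac{N}{2(N-1)}} \frac{1}{NT}\sum_{i=1}^{N}\sum_{t=1}^{T} \varepsilon_{i,t}^{2}\left(\left(\overline{\sigma^{-1}}\right)^{2} - 2\overline{\sigma^{-1}}\sigma_{i}^{-1} \right). \end{align*} Furthermore, let $\Omega = \left(1-2\mathbb{E}[\sigma_{i}]\mathbb{E}[\sigma_{i}^{-1}] + \mathbb{E}[\sigma_{i}^{2}](\mathbb{E}[\sigma_{i}^{-1}])^{2}\right)^2$. Then \begin{equation*} CD - \sqrt{T}\,\Xi \xrightarrow{d} N\left(0, \Omega \right) \end{equation*} as $N,T\to \infty$ jointly subject to the restriction $\sqrt{T}N^{-1} \to 0$.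
   Context: Panel model with additive time effects: $y_{i,t} = \mathbf{x}_{i,t}'\boldsymbol{\beta} + \tau_t + \mu_i + \varepsilon_{i,t}$, $i=1,\dots,N$, $t=1,\dots,T$, where $\mu_i$ is an entity-specific intercept and $\tau_t$ a time-specific common parameter. With $\boldsymbol{\beta}$ and $\mu_i$ known (w.l.o.g. $\boldsymbol{\beta}=\mathbf{0}$, $\mu_i=0$), the model reduces to $y_{i,t}=\tau_t+\varepsilon_{i,t}$; the time effects are estimated by $\hat\tau_t=\overline{y}_t=N^{-1}\sum_{i=1}^N y_{i,t}$ and residuals are $\hat\varepsilon_{i,t}=y_{i,t}-\hat\tau_t=\varepsilon_{i,t}-\overline{\varepsilon}_t$. The CD statistic (standardized with the known $\sigma_i$) is $CD=\sqrt{\frac{2}{TN(N-1)}}\sum_{i=2}^N\sum_{j=1}^{i-1}\sum_{t=1}^T \hat\varepsilon_{i,t}\hat\varepsilon_{j,t}/(\sigma_i\sigma_j)$. Notation: $\overline{\sigma^{k}}=N^{-1}\sum_{i=1}^N\sigma_i^k$. Assumption 1: (1) $\varepsilon_{i,t}=\sigma_i\eta_{i,t}$ where $\eta_{i,t}$ is i.i.d. across $i$ and $t$ with $\mathbb{E}[\eta_{i,t}]=0$, $\mathbb{E}[\eta_{i,t}^2]=1$, $\mathbb{E}[\eta_{i,t}^8]<M<\infty$; (2) $\sigma_i$ takes values in $[\delta,M]$ with $0<\delta<M<\infty$, is i.i.d. across $i$, and is independent of $\eta_{i,t}$ for all $i,t$. *)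

theory Defs
  imports "HOL-Probability.Probability"
begin

text \<open>Panel with N entities (indices i < N) and T periods (indices t < T), 0-based.
  eps i t = sg_i * eta_{i,t}; y_{i,t} = tau_t + eps_{i,t} (beta = 0, mu_i = 0 known).\<close>

definition eps :: "(nat \<Rightarrow> 'a \<Rightarrow> real) \<Rightarrow> (nat \<Rightarrow> nat \<Rightarrow> 'a \<Rightarrow> real) \<Rightarrow> nat \<Rightarrow> nat \<Rightarrow> 'a \<Rightarrow> real" where
  "eps sg eta i t \<omega> = sg i \<omega> * eta i t \<omega>"

definition yobs :: "(nat \<Rightarrow> real) \<Rightarrow> (nat \<Rightarrow> 'a \<Rightarrow> real) \<Rightarrow> (nat \<Rightarrow> nat \<Rightarrow> 'a \<Rightarrow> real) \<Rightarrow> nat \<Rightarrow> nat \<Rightarrow> 'a \<Rightarrow> real" where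
  "yobs tau sg eta i t \<omega> = tau t + eps sg eta i t \<omega>"

definition tauhat :: "(nat \<Rightarrow> real) \<Rightarrow> (nat \<Rightarrow> 'a \<Rightarrow> real) \<Rightarrow> (nat \<Rightarrow> nat \<Rightarrow> 'a \<Rightarrow> real) \<Rightarrow> nat \<Rightarrow> nat \<Rightarrow> 'a \<Rightarrow> real" where
  "tauhat tau sg eta N t \<omega> = (\<Sum>k<N. yobs tau sg eta k t \<omega>) / real N"

definition resid :: "(nat \<Rightarrow> real) \<Rightarrow> (nat \<Rightarrow> 'a \<Rightarrow> real) \<Rightarrow> (nat \<Rightarrow> nat \<Rightarrow> 'a \<Rightarrow> real) \<Rightarrow> nat \<Rightarrow> nat \<Rightarrow> nat \<Rightarrow> 'a \<Rightarrow> real" where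
  "resid tau sg eta N i t \<omega> = yobs tau sg eta i t \<omega> - tauhat tau sg eta N t \<omega>"

definition CD :: "(nat \<Rightarrow> real) \<Rightarrow> (nat \<Rightarrow> 'a \<Rightarrow> real) \<Rightarrow> (nat \<Rightarrow> nat \<Rightarrow> 'a \<Rightarrow> real) \<Rightarrow> nat \<Rightarrow> nat \<Rightarrow> 'a \<Rightarrow> real" where
  "CD tau sg eta N T \<omega> =
     sqrt (2 / (real T * real N * (real N - 1))) *
     (\<Sum>i<N. \<Sum>j<i. \<Sum>t<T. resid tau sg eta N i t \<omega> * resid tau sg eta N j t \<omega>
                              / (sg i \<omega> * sg j \<omega>))"

definition sbar_inv :: "(nat \<Rightarrow> 'a \<Rightarrow> real) \<Rightarrow> nat \<Rightarrow> 'a \<Rightarrow> real" where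
  "sbar_inv sg N \<omega> = (\<Sum>k<N. 1 / sg k \<omega>) / real N"

definition Xi :: "(nat \<Rightarrow> 'a \<Rightarrow> real) \<Rightarrow> (nat \<Rightarrow> nat \<Rightarrow> 'a \<Rightarrow> real) \<Rightarrow> nat \<Rightarrow> nat \<Rightarrow> 'a \<Rightarrow> real" where
  "Xi sg eta N T \<omega> =
     sqrt (real N / (2 * (real N - 1))) * (1 / (real N * real T)) *
     (\<Sum>i<N. \<Sum>t<T. (eps sg eta i t \<omega>)\<^sup>2 *
         ((sbar_inv sg N \<omega>)\<^sup>2 - 2 * sbar_inv sg N \<omega> * (1 / sg i \<omega>)))"

definition Lead :: "(nat \<Rightarrow> 'a \<Rightarrow> real) \<Rightarrow> (nat \<Rightarrow> nat \<Rightarrow> 'a \<Rightarrow> real) \<Rightarrow> nat \<Rightarrow> nat \<Rightarrow> 'a \<Rightarrow> real" where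
  "Lead sg eta N T \<omega> =
     sqrt (2 / (real T * real N * (real N - 1))) *
     (\<Sum>i<N. \<Sum>j<i. \<Sum>t<T. eps sg eta i t \<omega> * eps sg eta j t \<omega> *
         (1 / sg i \<omega> - sbar_inv sg N \<omega>) * (1 / sg j \<omega> - sbar_inv sg N \<omega>))"

definition bigOP :: "'a measure \<Rightarrow> (nat \<Rightarrow> nat \<Rightarrow> 'a \<Rightarrow> real) \<Rightarrow> (nat \<Rightarrow> nat \<Rightarrow> real) \<Rightarrow> bool" where
  "bigOP M R r \<longleftrightarrow> (\<forall>e>0. \<exists>C>0. eventually
      (\<lambda>(N, T). measure M {\<omega> \<in> space M. \<bar>R N T \<omega>\<bar> > C * r N T} \<le> e)
      (at_top \<times>\<^sub>F at_top))"

text \<open>The normal distribution N(0, v) with variance v \<ge> 0 (degenerate at 0 if v = 0),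
  as the law of sqrt v * Z with Z standard normal.\<close>
definition normal_law :: "real \<Rightarrow> real measure" where
  "normal_law v = distr (density lborel std_normal_density) borel (\<lambda>x. sqrt v * x)"

end

theory Submission
  imports Defs
begin

text \<open>
  Write \<open>z\<^sub>i\<close> for the standardized residual of entity \<open>i\<close> in one period, \<open>a\<close> for the mean of the
  \<open>1 / \<sigma>\<^sub>i\<close> and \<open>b\<^sub>i = 1 - a \<sigma>\<^sub>i\<close>. Then \<open>\<Sum> z\<^sub>i = \<Sum> b\<^sub>i \<eta>\<^sub>i\<close>, and expressing sums over pairs by
  \<open>((\<Sum> z\<^sub>i)\<^sup>2 - \<Sum> z\<^sub>i\<^sup>2) / 2\<close> gives an exact identity \<open>CD = Lead + \<surd>T \<Xi> + R\<close>, where \<open>R\<close> consists of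
  cross terms with the cross-sectional mean of the errors and satisfies \<open>E |R| = O(\<surd>T / N)\<close>.

  For the limit law, condition on the \<open>\<sigma>\<^sub>i\<close>. The leading term becomes a sum over \<open>t\<close> of independent
  centered quadratic forms in the \<open>\<eta>\<^sub>i\<^sub>t\<close> with deterministic bounded weights, whose third absolute
  moments are \<open>O(N\<^sup>3)\<close>. So its characteristic function is within \<open>O(1 / \<surd>T)\<close> of a Gaussian one,
  uniformly in the weights. The conditional variance is \<open>\<Omega> + O(1 / \<surd>N)\<close> in mean by the law of large
  numbers for \<open>\<sigma>\<^sub>i\<close>, \<open>\<sigma>\<^sub>i\<^sup>2\<close> and \<open>1 / \<sigma>\<^sub>i\<close>, and Levy's continuity theorem applies. Every approximation
  is in \<open>L\<^sup>1\<close>, so it passes directly to characteristic functions.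
\<close>

section \<open>Moments of sums and quadratic forms of independent variables\<close>

lemma sum_power3_le:
  fixes y :: "nat \<Rightarrow> real"
  assumes "\<And>i. i < n \<Longrightarrow> 0 \<le> y i"
  shows "(\<Sum>i<n. y i) ^ 3 \<le> (real n)\<^sup>2 * (\<Sum>i<n. y i ^ 3)"
proof (cases "n = 0")
  case False
  \<comment> \<open>Jensen's inequality for the cube, convex on the nonnegative reals, with equal
    weights 1/n; multiplying by n^3 then gives the claim.\<close>
  have "(\<Sum>i<n. (1 / real n) *\<^sub>R y i) ^ 3 \<le> (\<Sum>i<n. (1 / real n) * y i ^ 3)"
    using False assms
    by (intro convex_on_sum[OF _ _ convex_power_odd[of 3]]) auto
  then have "((\<Sum>i<n. y i) / real n) ^ 3 \<le> (\<Sum>i<n. y i ^ 3) / real n"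
    by (simp add: sum_divide_distrib)
  then have "((\<Sum>i<n. y i) / real n) ^ 3 * real n ^ 3 \<le> (\<Sum>i<n. y i ^ 3) / real n * real n ^ 3"
    by (intro mult_right_mono) auto
  also have "(\<Sum>i<n. y i ^ 3) / real n * real n ^ 3 = (real n)\<^sup>2 * (\<Sum>i<n. y i ^ 3)"
    using False by (simp add: field_simps power2_eq_square power3_eq_cube)
  also have "((\<Sum>i<n. y i) / real n) ^ 3 * real n ^ 3 = (\<Sum>i<n. y i) ^ 3"
    using False by (simp flip: power_mult_distrib)
  finally show ?thesis .
qed simp

text \<open>In the binomial expansion the term s^5 x is kept exactly, because its mean vanishes when
  x is centered and independent of s. The terms with s^3 x^3, s^2 x^4 and s x^5 are absorbed into
  s^4 x^2 and x^6 by the arithmetic-geometric inequality, which produces the coefficients 39 and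
  18.\<close>

lemma power6_add_le:
  fixes s x :: real
  shows "(s + x) ^ 6 \<le> s ^ 6 + 6 * (s ^ 5 * x) + 39 * (s ^ 4 * x\<^sup>2) + 18 * x ^ 6"
proof -
  have 1: "2 * (s ^ 3 * x ^ 3) \<le> s ^ 4 * x\<^sup>2 + s\<^sup>2 * x ^ 4"
    using zero_le_power2[of "s * x * (s - x)"] by (simp add: power2_eq_square algebra_simps eval_nat_numeral)
  have 2: "2 * (s\<^sup>2 * x ^ 4) \<le> s ^ 4 * x\<^sup>2 + x ^ 6"
    using zero_le_power2[of "x * (s * s - x * x)"] by (simp add: power2_eq_square algebra_simps eval_nat_numeral)
  have 3: "2 * (s * x ^ 5) \<le> s\<^sup>2 * x ^ 4 + x ^ 6"
    using zero_le_power2[of "x * x * (s - x)"] by (simp add: power2_eq_square algebra_simps eval_nat_numeral)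
  have "(s + x) ^ 6 = s ^ 6 + 6 * (s ^ 5 * x) + 15 * (s ^ 4 * x\<^sup>2) + 20 * (s ^ 3 * x ^ 3)
      + 15 * (s\<^sup>2 * x ^ 4) + 6 * (s * x ^ 5) + x ^ 6"
    by (simp add: algebra_simps eval_nat_numeral)
  with 1 2 3 show ?thesis by linarith
qed

text \<open>Either s^2 exceeds l and s^4 is at most s^6 / l, or s^4 is at most l^2. The threshold l
  stays free so that the sixth-moment recursion can let it grow with n.\<close>

lemma power4_le_power6:
  fixes s l :: real
  assumes "l > 0"
  shows "s ^ 4 \<le> s ^ 6 / l + l\<^sup>2"
proof (cases "s\<^sup>2 \<le> l")
  case True
  then have "(s\<^sup>2)\<^sup>2 \<le> l\<^sup>2" by (intro power_mono) auto
  then have "s ^ 4 \<le> l\<^sup>2" by simp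
  moreover have "0 \<le> s ^ 6 / l" using assms by (simp add: zero_le_even_power)
  ultimately show ?thesis by linarith
next
  case False
  then have "s ^ 4 * l \<le> s ^ 4 * s\<^sup>2" by (intro mult_left_mono) (auto simp: zero_le_even_power)
  also have "\<dots> = s ^ 6" by (simp flip: power_add)
  finally have "s ^ 4 \<le> s ^ 6 / l" using assms by (simp add: field_simps)
  then show ?thesis using zero_le_power2[of l] by linarith
qed

lemma abs_power_le_one_plus:
  fixes x :: real
  assumes "k \<le> n"
  shows "\<bar>x\<bar> ^ k \<le> 1 + \<bar>x\<bar> ^ n"
proof (cases "\<bar>x\<bar> \<le> 1")
  case True
  then have "\<bar>x\<bar> ^ k \<le> 1" by (simp add: power_le_one)
  then show ?thesis by (simp add: add_increasing2)
next
  case False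
  then have "\<bar>x\<bar> ^ k \<le> \<bar>x\<bar> ^ n" using assms by (intro power_increasing) auto
  then show ?thesis by simp
qed

lemma sum_pairs_eq:
  fixes x :: "nat \<Rightarrow> real"
  shows "(\<Sum>i<n. \<Sum>j<i. x i * x j) = ((\<Sum>i<n. x i)\<^sup>2 - (\<Sum>i<n. (x i)\<^sup>2)) / 2"
proof (induction n)
  case (Suc n)
  then show ?case
    by (simp add: power2_eq_square algebra_simps flip: sum_distrib_left)
qed simp

section \<open>Moments of sums and pair sums of independent centered variables\<close>

lemma (in prob_space) integrable_power_le:
  fixes f :: "'a \<Rightarrow> real"
  assumes [measurable]: "f \<in> borel_measurable M" and "integrable M (\<lambda>\<omega>. \<bar>f \<omega>\<bar> ^ n)" and "k \<le> n"
  shows "integrable M (\<lambda>\<omega>. f \<omega> ^ k)"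
  by (rule Bochner_Integration.integrable_bound[of M "\<lambda>\<omega>. 1 + \<bar>f \<omega>\<bar> ^ n"])
     (use assms abs_power_le_one_plus[OF \<open>k \<le> n\<close>] in \<open>auto simp: power_abs\<close>)

text \<open>The numbers 39 and 18 are the coefficients in \<open>power6_add_le\<close>; the cube
  collects what the choice l = 39 (1 + m) n leaves over in the recursion for the sixth
  moment.\<close>

definition moment6_const :: "real \<Rightarrow> real" where
  "moment6_const m = (39 * (1 + m)) ^ 3 + 18 * m"

text \<open>The laws may vary with i under a common bound m, since the variables will be errors
  multiplied by weights that depend on the entity. Sixth moments are bounded because they control
  third absolute moments of quadratic forms.\<close>

locale centered_indep_seq = prob_space M for M :: "'a measure" +
  fixes X :: "nat \<Rightarrow> 'a \<Rightarrow> real" and m :: real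
  assumes indep_X: "indep_vars (\<lambda>_. borel) X UNIV"
    and mean_X: "expectation (X i) = 0"
    and int6_X: "integrable M (\<lambda>\<omega>. X i \<omega> ^ 6)"
    and moment6_X: "expectation (\<lambda>\<omega>. X i \<omega> ^ 6) \<le> m"
begin

definition S :: "nat \<Rightarrow> 'a \<Rightarrow> real" where
  "S n \<omega> = (\<Sum>i<n. X i \<omega>)"

definition Q :: "nat \<Rightarrow> 'a \<Rightarrow> real" where
  "Q n \<omega> = (\<Sum>i<n. \<Sum>j<i. X i \<omega> * X j \<omega>)"

lemma S_simps: "S 0 \<omega> = 0" "S (Suc n) \<omega> = S n \<omega> + X n \<omega>"
  by (simp_all add: S_def)

lemma Q_simps: "Q 0 \<omega> = 0" "Q (Suc n) \<omega> = Q n \<omega> + S n \<omega> * X n \<omega>"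
  by (simp_all add: Q_def S_def sum_distrib_left mult.commute)

lemma X_meas [measurable]: "X i \<in> borel_measurable M"
  using indep_X by (auto simp: indep_vars_def)

lemma S_meas [measurable]: "S n \<in> borel_measurable M"
  unfolding S_def[abs_def] by measurable

lemma Q_meas [measurable]: "Q n \<in> borel_measurable M"
  unfolding Q_def[abs_def] by measurable

lemma m_nonneg: "0 \<le> m"
  by (rule order_trans[OF integral_nonneg_AE moment6_X[of 0]]) (auto simp: zero_le_even_power)

text \<open>\<open>S n\<close> and \<open>Q n\<close> are functions of the coordinates below n only,
  so they are jointly independent of \<open>X n\<close>. This is what makes the cross terms vanish
  in all inductions on n below.\<close>

lemma indep_past:
  assumes h: "(\<lambda>(s, q). h s q) \<in> borel_measurable (borel \<Otimes>\<^sub>M borel)"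
    and g: "g \<in> borel_measurable borel"
  shows "indep_var borel (\<lambda>\<omega>. h (S n \<omega>) (Q n \<omega>) :: real) borel (\<lambda>\<omega>. g (X n \<omega>) :: real)"
proof -
  define p where "p x = h (\<Sum>i<n. x i) (\<Sum>i<n. \<Sum>j<i. x i * x j)" for x :: "nat \<Rightarrow> real"
  have [measurable]: "(\<lambda>x. x i) \<in> borel_measurable (PiM {..<n} (\<lambda>_. borel))" if "i < n" for i
    using that by (intro measurable_component_singleton) auto
  have "(\<lambda>x. (\<Sum>i<n. x i, \<Sum>i<n. \<Sum>j<i. x i * x j)) \<in> PiM {..<n} (\<lambda>_. borel) \<rightarrow>\<^sub>M borel \<Otimes>\<^sub>M (borel :: real measure)"
    by (intro measurable_Pair borel_measurable_sum borel_measurable_times) auto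
  from measurable_compose[OF this h] have p: "p \<in> borel_measurable (PiM {..<n} (\<lambda>_. borel))"
    by (simp add: p_def[abs_def])
  have g': "(\<lambda>x. g (x n)) \<in> borel_measurable (PiM {n} (\<lambda>_. borel))"
    by (rule measurable_compose[OF _ g]) (rule measurable_component_singleton, simp)
  have "indep_var (PiM {..<n} (\<lambda>_. borel)) (\<lambda>\<omega>. restrict (\<lambda>i. X i \<omega>) {..<n})
      (PiM {n} (\<lambda>_. borel)) (\<lambda>\<omega>. restrict (\<lambda>i. X i \<omega>) {n})"
    by (intro indep_var_restrict[OF indep_X]) auto
  from indep_var_compose[OF this p g'] show ?thesis
    by (simp add: comp_def p_def S_def Q_def)
qed

lemma int_X: "k \<le> 6 \<Longrightarrow> integrable M (\<lambda>\<omega>. X i \<omega> ^ k)"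
  by (rule integrable_power_le[OF _ int6_X[THEN integrable_abs, unfolded power_abs]]) auto

lemma int6_S: "integrable M (\<lambda>\<omega>. S n \<omega> ^ 6)"
proof (induction n)
  case (Suc n)
  have le: "(s + x) ^ 6 \<le> 2 ^ 6 * (s ^ 6 + x ^ 6)" for s x :: real
  proof -
    have "\<bar>s + x\<bar> ^ 6 \<le> (2 * max \<bar>s\<bar> \<bar>x\<bar>) ^ 6"
      by (intro power_mono) auto
    also have "\<dots> = 2 ^ 6 * (max \<bar>s\<bar> \<bar>x\<bar>) ^ 6" by (simp add: power_mult_distrib)
    also have "\<dots> \<le> 2 ^ 6 * (s ^ 6 + x ^ 6)"
      by (intro mult_left_mono) (auto simp: max_def power_even_abs zero_le_even_power)
    finally show ?thesis by (simp add: power_even_abs)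
  qed
  show ?case
    unfolding S_simps
    by (rule Bochner_Integration.integrable_bound[of M "\<lambda>\<omega>. 2 ^ 6 * (S n \<omega> ^ 6 + X n \<omega> ^ 6)"])
       (use Suc int6_X le in \<open>auto simp: zero_le_even_power add_nonneg_nonneg\<close>)
qed (simp add: S_simps)

lemma int_S: "k \<le> 6 \<Longrightarrow> integrable M (\<lambda>\<omega>. S n \<omega> ^ k)"
  by (rule integrable_power_le[OF _ int6_S[THEN integrable_abs, unfolded power_abs]]) auto

lemma
  assumes "k \<le> 6" "l \<le> 6"
  shows int_SX: "integrable M (\<lambda>\<omega>. S n \<omega> ^ k * X n \<omega> ^ l)"
    and mean_SX: "expectation (\<lambda>\<omega>. S n \<omega> ^ k * X n \<omega> ^ l)
      = expectation (\<lambda>\<omega>. S n \<omega> ^ k) * expectation (\<lambda>\<omega>. X n \<omega> ^ l)"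
proof -
  have i: "indep_var borel (\<lambda>\<omega>. S n \<omega> ^ k) borel (\<lambda>\<omega>. X n \<omega> ^ l)"
    by (rule indep_past[where h="\<lambda>s q. s ^ k" and g="\<lambda>x. x ^ l"]) measurable
  show "integrable M (\<lambda>\<omega>. S n \<omega> ^ k * X n \<omega> ^ l)"
    by (rule indep_var_integrable[OF i int_S int_X]) (use assms in auto)
  show "expectation (\<lambda>\<omega>. S n \<omega> ^ k * X n \<omega> ^ l)
      = expectation (\<lambda>\<omega>. S n \<omega> ^ k) * expectation (\<lambda>\<omega>. X n \<omega> ^ l)"
    by (rule indep_var_lebesgue_integral[OF i int_S int_X]) (use assms in auto)
qed

lemma second_moment_S: "expectation (\<lambda>\<omega>. (S n \<omega>)\<^sup>2) = (\<Sum>i<n. expectation (\<lambda>\<omega>. (X i \<omega>)\<^sup>2))"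
proof (induction n)
  case (Suc n)
  have "expectation (\<lambda>\<omega>. (S (Suc n) \<omega>)\<^sup>2)
      = expectation (\<lambda>\<omega>. (S n \<omega>)\<^sup>2 + 2 * (S n \<omega> ^ 1 * X n \<omega> ^ 1) + (X n \<omega>)\<^sup>2)"
    by (simp add: S_simps power2_sum algebra_simps)
  also have "\<dots> = expectation (\<lambda>\<omega>. (S n \<omega>)\<^sup>2) + 2 * expectation (\<lambda>\<omega>. S n \<omega> ^ 1 * X n \<omega> ^ 1)
      + expectation (\<lambda>\<omega>. (X n \<omega>)\<^sup>2)"
    using int_SX[of 1 1 n] int_S[of 2 n] int_X[of 2 n] by simp
  also have "expectation (\<lambda>\<omega>. S n \<omega> ^ 1 * X n \<omega> ^ 1) = 0"
    using mean_SX[of 1 1 n] mean_X by simp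
  finally show ?case using Suc by simp
qed (simp add: S_simps)

lemma second_moment_X_le: "expectation (\<lambda>\<omega>. (X i \<omega>)\<^sup>2) \<le> 1 + m"
proof -
  have "expectation (\<lambda>\<omega>. (X i \<omega>)\<^sup>2) \<le> expectation (\<lambda>\<omega>. 1 + X i \<omega> ^ 6)"
    using int_X[of 2 i] int6_X[of i] abs_power_le_one_plus[of 2 6]
    by (intro integral_mono) (auto simp: power_even_abs)
  also have "\<dots> \<le> 1 + m" using int6_X[of i] moment6_X[of i] by (simp add: prob_space)
  finally show ?thesis .
qed

text \<open>Spending the factor \<open>1 + 1/n\<close> on the quartic cross term makes the recursion close at the
  optimal rate, so no separate bound on the fourth moment is needed.\<close>

lemma sixth_moment_S: "expectation (\<lambda>\<omega>. S n \<omega> ^ 6) \<le> moment6_const m * real n ^ 3"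
proof (induction n)
  case (Suc n)
  have C: "0 \<le> moment6_const m" "m \<le> moment6_const m" using m_nonneg by (auto simp: moment6_const_def)
  show ?case
  proof (cases "n = 0")
    case True
    then show ?thesis using moment6_X[of 0] C by (simp add: S_simps)
  next
    case False
    define v where "v = 1 + m"
    \<comment> \<open>Chosen so that 39 v / l = 1/n: the quartic term then costs only the factor 1 +
      1/n on the sixth moment, plus (39 v)^3 n^2.\<close>
    define l where "l = 39 * v * real n"
    have v: "v \<ge> 1" using m_nonneg by (simp add: v_def)
    have l: "l > 0" using v False by (simp add: l_def)
    have "expectation (\<lambda>\<omega>. S (Suc n) \<omega> ^ 6)
      \<le> expectation (\<lambda>\<omega>. S n \<omega> ^ 6 + 6 * (S n \<omega> ^ 5 * X n \<omega> ^ 1) + 39 * (S n \<omega> ^ 4 * X n \<omega> ^ 2) + 18 * X n \<omega> ^ 6)"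
      using int6_S[of "Suc n"] int6_S[of n] int_SX[of 5 1 n] int_SX[of 4 2 n] int6_X[of n]
        power6_add_le
      by (intro integral_mono) (auto simp: S_simps)
    also have "\<dots> = expectation (\<lambda>\<omega>. S n \<omega> ^ 6) + 6 * expectation (\<lambda>\<omega>. S n \<omega> ^ 5 * X n \<omega> ^ 1)
      + 39 * expectation (\<lambda>\<omega>. S n \<omega> ^ 4 * X n \<omega> ^ 2) + 18 * expectation (\<lambda>\<omega>. X n \<omega> ^ 6)"
      using int6_S[of n] int_SX[of 5 1 n] int_SX[of 4 2 n] int6_X[of n] by simp
    also have "expectation (\<lambda>\<omega>. S n \<omega> ^ 5 * X n \<omega> ^ 1) = 0"
      using mean_SX[of 5 1 n] mean_X by simp
    also have "expectation (\<lambda>\<omega>. S n \<omega> ^ 4 * X n \<omega> ^ 2)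
        \<le> (expectation (\<lambda>\<omega>. S n \<omega> ^ 6) / l + l\<^sup>2) * v"
    proof -
      have "expectation (\<lambda>\<omega>. S n \<omega> ^ 4) \<le> expectation (\<lambda>\<omega>. S n \<omega> ^ 6 / l + l\<^sup>2)"
        using int_S[of 4 n] int6_S[of n] power4_le_power6[OF l]
        by (intro integral_mono) auto
      also have "\<dots> = expectation (\<lambda>\<omega>. S n \<omega> ^ 6) / l + l\<^sup>2"
        using int6_S[of n] by (simp add: prob_space)
      finally have "expectation (\<lambda>\<omega>. S n \<omega> ^ 4) \<le> expectation (\<lambda>\<omega>. S n \<omega> ^ 6) / l + l\<^sup>2" .
      moreover have "0 \<le> expectation (\<lambda>\<omega>. S n \<omega> ^ 4)"
        by (intro integral_nonneg_AE) (auto simp: zero_le_even_power)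
      moreover have "0 \<le> expectation (\<lambda>\<omega>. X n \<omega> ^ 2)"
        by (intro integral_nonneg_AE) auto
      ultimately have "expectation (\<lambda>\<omega>. S n \<omega> ^ 4) * expectation (\<lambda>\<omega>. X n \<omega> ^ 2)
          \<le> (expectation (\<lambda>\<omega>. S n \<omega> ^ 6) / l + l\<^sup>2) * v"
        using second_moment_X_le[of n] by (intro mult_mono) (linarith | simp add: v_def)+
      then show ?thesis using mean_SX[of 4 2 n] by simp
    qed
    also have "expectation (\<lambda>\<omega>. S n \<omega> ^ 6) + 6 * 0 + 39 * ((expectation (\<lambda>\<omega>. S n \<omega> ^ 6) / l + l\<^sup>2) * v)
         + 18 * expectation (\<lambda>\<omega>. X n \<omega> ^ 6)
      = expectation (\<lambda>\<omega>. S n \<omega> ^ 6) * (1 + 1 / real n) + (39 * v) ^ 3 * (real n)\<^sup>2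
         + 18 * expectation (\<lambda>\<omega>. X n \<omega> ^ 6)"
      using v False by (simp add: l_def field_simps power2_eq_square power3_eq_cube)
    also have "\<dots> \<le> (moment6_const m * real n ^ 3) * (1 + 1 / real n) + (39 * v) ^ 3 * (real n)\<^sup>2 + 18 * m * (real n)\<^sup>2"
    proof -
      have "18 * expectation (\<lambda>\<omega>. X n \<omega> ^ 6) \<le> 18 * m * 1"
        using moment6_X[of n] by simp
      also have "\<dots> \<le> 18 * m * (real n)\<^sup>2"
        using m_nonneg False by (intro mult_left_mono) auto
      finally show ?thesis using Suc by (intro add_mono mult_right_mono) auto
    qed
    \<comment> \<open>One n^2 comes from the factor 1 + 1/n and one from the additive terms, whose
      coefficients sum to \<open>moment6_const m\<close>. Since (n + 1)^3 contains 3 n^2, the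
      induction closes.\<close>
    also have "\<dots> = moment6_const m * (real n ^ 3 + 2 * (real n)\<^sup>2)"
      using False by (simp add: moment6_const_def v_def field_simps power2_eq_square power3_eq_cube)
    also have "\<dots> \<le> moment6_const m * real (Suc n) ^ 3"
      using C by (intro mult_left_mono) (auto simp: power2_eq_square power3_eq_cube algebra_simps)
    finally show ?thesis by simp
  qed
qed (simp add: S_simps)

text \<open>\<open>Q n\<close> is half the difference of the nonnegative numbers a =
  (\<open>S n\<close>)^2 and b, the sum of the squares, hence at most their maximum in absolute
  value. The cube of the maximum is at most a^3 + b^3, and \<open>sum_power3_le\<close> handles
  b^3.\<close>

lemma abs_Q3_le: "\<bar>Q n \<omega>\<bar> ^ 3 \<le> (S n \<omega>) ^ 6 + (real n)\<^sup>2 * (\<Sum>i<n. X i \<omega> ^ 6)"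
proof -
  define a where "a = (S n \<omega>)\<^sup>2"
  define b where "b = (\<Sum>i<n. (X i \<omega>)\<^sup>2)"
  have ab: "a \<ge> 0" "b \<ge> 0" by (auto simp: a_def b_def intro: sum_nonneg)
  have "Q n \<omega> = (a - b) / 2"
    unfolding Q_def sum_pairs_eq a_def b_def S_def ..
  then have "\<bar>Q n \<omega>\<bar> \<le> max a b" using ab by (auto simp: max_def abs_if)
  then have "\<bar>Q n \<omega>\<bar> ^ 3 \<le> (max a b) ^ 3" by (intro power_mono) auto
  also have "\<dots> \<le> a ^ 3 + b ^ 3" using ab by (auto simp: max_def)
  also have "b ^ 3 \<le> (real n)\<^sup>2 * (\<Sum>i<n. X i \<omega> ^ 6)"
    using sum_power3_le[of n "\<lambda>i. (X i \<omega>)\<^sup>2"] by (simp add: b_def)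
  finally show ?thesis by (simp add: a_def)
qed

lemma int3_Q: "integrable M (\<lambda>\<omega>. \<bar>Q n \<omega>\<bar> ^ 3)"
  by (rule Bochner_Integration.integrable_bound[of M
      "\<lambda>\<omega>. (S n \<omega>) ^ 6 + (real n)\<^sup>2 * (\<Sum>i<n. X i \<omega> ^ 6)"])
     (use int6_S int6_X abs_Q3_le[of n] in
       \<open>auto simp: zero_le_even_power intro!: abs_of_nonneg[symmetric, THEN [2] ord_le_eq_trans]
          add_nonneg_nonneg sum_nonneg mult_nonneg_nonneg\<close>)

lemma third_moment_Q: "expectation (\<lambda>\<omega>. \<bar>Q n \<omega>\<bar> ^ 3) \<le> (moment6_const m + m) * real n ^ 3"
proof -
  have "expectation (\<lambda>\<omega>. \<bar>Q n \<omega>\<bar> ^ 3)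
      \<le> expectation (\<lambda>\<omega>. (S n \<omega>) ^ 6 + (real n)\<^sup>2 * (\<Sum>i<n. X i \<omega> ^ 6))"
    using int3_Q int6_S int6_X abs_Q3_le by (intro integral_mono) auto
  also have "\<dots> = expectation (\<lambda>\<omega>. (S n \<omega>) ^ 6) + (real n)\<^sup>2 * (\<Sum>i<n. expectation (\<lambda>\<omega>. X i \<omega> ^ 6))"
    using int6_S int6_X by simp
  also have "\<dots> \<le> moment6_const m * real n ^ 3 + (real n)\<^sup>2 * (\<Sum>i<n. m)"
    by (intro add_mono mult_left_mono sum_mono sixth_moment_S moment6_X) auto
  also have "\<dots> = (moment6_const m + m) * real n ^ 3"
    by (simp add: algebra_simps power2_eq_square power3_eq_cube)
  finally show ?thesis .
qed

lemma int_Q: "k \<le> 3 \<Longrightarrow> integrable M (\<lambda>\<omega>. Q n \<omega> ^ k)"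
  by (rule integrable_power_le[OF _ int3_Q]) auto

lemma mean_Q: "expectation (Q n) = 0"
proof (induction n)
  case (Suc n)
  have "expectation (Q (Suc n)) = expectation (\<lambda>\<omega>. Q n \<omega> ^ 1 + S n \<omega> ^ 1 * X n \<omega> ^ 1)"
    by (intro Bochner_Integration.integral_cong) (auto simp: Q_simps)
  also have "\<dots> = expectation (\<lambda>\<omega>. Q n \<omega> ^ 1) + expectation (\<lambda>\<omega>. S n \<omega> ^ 1 * X n \<omega> ^ 1)"
    by (intro Bochner_Integration.integral_add int_Q int_SX) auto
  finally show ?case using Suc mean_SX[of 1 1 n] mean_X by simp
qed (simp add: Q_simps[abs_def])

text \<open>\<open>Q\<close> behaves like a martingale with increments \<open>S n * X n\<close>. As
  \<open>X n\<close> is centered and independent of the pair (\<open>S n\<close>,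
  \<open>Q n\<close>), the increment is uncorrelated with \<open>Q n\<close>, so second moments add
  and that of the increment factorizes.\<close>

lemma second_moment_Q:
  "expectation (\<lambda>\<omega>. (Q n \<omega>)\<^sup>2)
    = (\<Sum>i<n. \<Sum>j<i. expectation (\<lambda>\<omega>. (X i \<omega>)\<^sup>2) * expectation (\<lambda>\<omega>. (X j \<omega>)\<^sup>2))"
proof (induction n)
  case (Suc n)
  have i: "indep_var borel (\<lambda>\<omega>. S n \<omega> * Q n \<omega>) borel (\<lambda>\<omega>. X n \<omega>)"
    by (rule indep_past[where h="\<lambda>s q. s * q" and g="\<lambda>x. x"]) measurable
  have SQ: "integrable M (\<lambda>\<omega>. S n \<omega> * Q n \<omega>)"
  proof (rule Bochner_Integration.integrable_bound[of M "\<lambda>\<omega>. (S n \<omega>)\<^sup>2 + (Q n \<omega>)\<^sup>2"])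
    have "\<bar>s * q\<bar> \<le> s\<^sup>2 + q\<^sup>2" for s q :: real
    proof -
      have "2 * \<bar>s * q\<bar> \<le> s\<^sup>2 + q\<^sup>2"
        using zero_le_power2[of "\<bar>s\<bar> - \<bar>q\<bar>"] by (simp add: power2_diff abs_mult)
      then show ?thesis using abs_ge_zero[of "s * q"] by linarith
    qed
    then show "AE \<omega> in M. norm (S n \<omega> * Q n \<omega>) \<le> norm ((S n \<omega>)\<^sup>2 + (Q n \<omega>)\<^sup>2)"
      by auto
  qed (use int_S[of 2 n] int_Q[of 2 n] in auto)
  have X1: "integrable M (X n)" using int_X[of 1 n] by simp
  have I: "integrable M (\<lambda>\<omega>. (S n \<omega> * Q n \<omega>) * X n \<omega>)"
    by (rule indep_var_integrable[OF i SQ X1])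
  have E: "expectation (\<lambda>\<omega>. (S n \<omega> * Q n \<omega>) * X n \<omega>) = 0"
    using indep_var_lebesgue_integral[OF i SQ X1] mean_X by simp
  have "expectation (\<lambda>\<omega>. (Q (Suc n) \<omega>)\<^sup>2)
      = expectation (\<lambda>\<omega>. (Q n \<omega>)\<^sup>2 + 2 * ((S n \<omega> * Q n \<omega>) * X n \<omega>) + (S n \<omega>)\<^sup>2 * (X n \<omega>)\<^sup>2)"
    by (simp add: Q_simps power2_sum power_mult_distrib algebra_simps)
  also have "\<dots> = expectation (\<lambda>\<omega>. (Q n \<omega>)\<^sup>2) + 2 * expectation (\<lambda>\<omega>. (S n \<omega> * Q n \<omega>) * X n \<omega>)
      + expectation (\<lambda>\<omega>. (S n \<omega>)\<^sup>2 * (X n \<omega>)\<^sup>2)"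
    using int_Q[of 2 n] I int_SX[of 2 2 n] by simp
  also have "\<dots> = expectation (\<lambda>\<omega>. (Q n \<omega>)\<^sup>2)
      + (\<Sum>j<n. expectation (\<lambda>\<omega>. (X j \<omega>)\<^sup>2)) * expectation (\<lambda>\<omega>. (X n \<omega>)\<^sup>2)"
    unfolding E using mean_SX[of 2 2 n] second_moment_S[of n] by simp
  finally show ?case using Suc by (simp add: sum_distrib_left ac_simps)
qed (simp add: Q_simps)

end

section \<open>Characteristic functions and conditioning\<close>

lemma abs_one_minus_minus_exp_le:
  fixes x :: real
  assumes "0 \<le> x"
  shows "\<bar>(1 - x) - exp (- x)\<bar> \<le> x\<^sup>2 / 2"
proof -
  have lower: "1 - x \<le> exp (- x)" using exp_ge_add_one_self[of "- x"] by simp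
  \<comment> \<open>\<open>g\<close> vanishes at 0 and has the nonnegative derivative exp(-y) - 1 +
    y, so \<open>g x\<close> is nonnegative; this is the upper bound on exp(-x).\<close>
  define g where "g y = 1 - y + y\<^sup>2 / 2 - exp (- y)" for y :: real
  have "g 0 \<le> g x"
  proof (rule DERIV_nonneg_imp_nondecreasing[OF assms])
    fix y :: real assume "0 \<le> y"
    have "(g has_real_derivative (- 1 + y + exp (- y))) (at y)"
      unfolding g_def by (auto intro!: derivative_eq_intros)
    moreover have "0 \<le> - 1 + y + exp (- y)" using exp_ge_add_one_self[of "- y"] by simp
    ultimately show "\<exists>z. (g has_real_derivative z) (at y) \<and> 0 \<le> z" by blast
  qed
  with lower show ?thesis by (simp add: g_def)
qed

text \<open>The map x to exp(-x) is 1-Lipschitz on the nonnegative half-line. It turns closeness of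
  two variances into closeness of the corresponding Gaussian characteristic functions.\<close>

lemma abs_exp_minus_diff_le:
  fixes x y :: real
  assumes "0 \<le> x" "0 \<le> y"
  shows "\<bar>exp (- x) - exp (- y)\<bar> \<le> \<bar>x - y\<bar>"
proof -
  have "exp (- a) - exp (- b) \<le> b - a" if "0 \<le> a" "a \<le> b" for a b :: real
  proof -
    have "exp (- a) - exp (- b) = exp (- a) * (1 - exp (- (b - a)))"
      by (simp add: algebra_simps flip: exp_add)
    also have "\<dots> \<le> 1 * (b - a)"
      using that exp_ge_add_one_self[of "- (b - a)"] by (intro mult_mono) (auto simp del: minus_diff_eq)
    finally show ?thesis by simp
  qed
  from this[of x y] this[of y x] assms show ?thesis
    by (cases "x \<le> y") (auto simp: abs_if)
qed

section \<open>Characteristic functions and integration over independent blocks\<close>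

context prob_space
begin

text \<open>A central limit theorem with an explicit error, so that it can be applied with the same
  bound for all weights arising from conditioning. The characteristic function of the sum and the
  Gaussian target are both products of T factors in the unit disc, and such products differ by at
  most the sum of the differences of their factors.\<close>

lemma char_sum_normal_approx:
  fixes Y :: "nat \<Rightarrow> 'a \<Rightarrow> real"
  assumes indep: "indep_vars (\<lambda>_. borel) Y {..<T}"
    and int: "\<And>t. t < T \<Longrightarrow> integrable M (Y t)" "\<And>t. t < T \<Longrightarrow> integrable M (\<lambda>\<omega>. (Y t \<omega>)\<^sup>2)"
      "\<And>t. t < T \<Longrightarrow> integrable M (\<lambda>\<omega>. \<bar>Y t \<omega>\<bar> ^ 3)"
    and mean: "\<And>t. t < T \<Longrightarrow> expectation (Y t) = 0"
    and var: "\<And>t. t < T \<Longrightarrow> expectation (\<lambda>\<omega>. (Y t \<omega>)\<^sup>2) = v"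
    and third: "\<And>t. t < T \<Longrightarrow> expectation (\<lambda>\<omega>. \<bar>Y t \<omega>\<bar> ^ 3) \<le> k"
    and v: "0 \<le> v"
  shows "cmod (char (distr M borel (\<lambda>\<omega>. \<Sum>t<T. Y t \<omega>)) w - exp (- (real T * (w\<^sup>2 * v / 2))))
    \<le> real T * (\<bar>w\<bar> ^ 3 * k / 6 + (w\<^sup>2 * v)\<^sup>2 / 8)"
proof -
  define x where "x = w\<^sup>2 * v / 2"
  have x: "0 \<le> x" using v by (simp add: x_def)
  have rv[measurable]: "Y t \<in> borel_measurable M" if "t < T" for t
    using indep that by (auto simp: indep_vars_def)
  have step: "cmod (char (distr M borel (Y t)) w - complex_of_real (exp (- x)))
      \<le> \<bar>w\<bar> ^ 3 * k / 6 + (w\<^sup>2 * v)\<^sup>2 / 8" if t: "t < T" for t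
  proof -
    have "cmod (char (distr M borel (Y t)) w - (1 - w\<^sup>2 * v / 2))
      \<le> (w\<^sup>2 / 6) * expectation (\<lambda>\<omega>. min (6 * (Y t \<omega>)\<^sup>2) (\<bar>w\<bar> * \<bar>Y t \<omega>\<bar> ^ 3))"
      using t int mean var rv by (intro char_approx3') auto
    \<comment> \<open>The minimum in the Taylor remainder is replaced by its cubic argument, since a
      third moment yields a rate.\<close>
    also have "\<dots> \<le> (w\<^sup>2 / 6) * expectation (\<lambda>\<omega>. \<bar>w\<bar> * \<bar>Y t \<omega>\<bar> ^ 3)"
      using t int rv
      by (intro mult_left_mono integral_mono integrable_min) auto
    also have "\<dots> \<le> (w\<^sup>2 / 6) * (\<bar>w\<bar> * k)"
      using third[OF t] by (intro mult_left_mono) (auto intro!: mult_left_mono)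
    also have "\<dots> = \<bar>w\<bar> ^ 3 * k / 6"
      using power2_abs[of w] by (simp add: power2_eq_square power3_eq_cube)
    finally have 1: "cmod (char (distr M borel (Y t)) w - (1 - x)) \<le> \<bar>w\<bar> ^ 3 * k / 6"
      by (simp add: x_def)
    \<comment> \<open>Passing from the second-order expansion 1 - x to the Gaussian factor
      exp(-x).\<close>
    have "cmod (complex_of_real (1 - x) - complex_of_real (exp (- x))) \<le> x\<^sup>2 / 2"
      using abs_one_minus_minus_exp_le[OF x] unfolding of_real_diff[symmetric] norm_of_real .
    moreover have "x\<^sup>2 / 2 = (w\<^sup>2 * v)\<^sup>2 / 8" by (simp add: x_def power_divide)
    ultimately show ?thesis
      using 1 norm_triangle_ineq[of "char (distr M borel (Y t)) w - (1 - x)"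
          "complex_of_real (1 - x) - complex_of_real (exp (- x))"]
      by simp
  qed
  have "complex_of_real (exp (- (real T * x))) = (\<Prod>t<T. complex_of_real (exp (- x)))"
    by (simp flip: of_real_power exp_of_nat_mult)
  then have "cmod (char (distr M borel (\<lambda>\<omega>. \<Sum>t<T. Y t \<omega>)) w - exp (- (real T * x)))
    = cmod ((\<Prod>t<T. char (distr M borel (Y t)) w) - (\<Prod>t<T. complex_of_real (exp (- x))))"
    using char_distr_sum[OF indep, of w] by simp
  also have "\<dots> \<le> (\<Sum>t<T. cmod (char (distr M borel (Y t)) w - complex_of_real (exp (- x))))"
    using x rv
    by (intro norm_prod_diff real_distribution.cmod_char_le_1 real_distribution_distr) auto
  also have "\<dots> \<le> (\<Sum>t<T. \<bar>w\<bar> ^ 3 * k / 6 + (w\<^sup>2 * v)\<^sup>2 / 8)"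
    using step by (intro sum_mono) auto
  finally show ?thesis by (simp add: x_def)
qed

text \<open>This stands in for conditioning on \<open>X\<close>: the inner integral sees \<open>X\<close> as a constant.\<close>

lemma
  fixes f :: "'b \<times> 'b \<Rightarrow> 'd::{banach, second_countable_topology}"
  assumes indep: "indep_var MX X MY Y"
    and f [measurable]: "f \<in> borel_measurable (MX \<Otimes>\<^sub>M MY)"
    and int: "integrable M (\<lambda>\<omega>. f (X \<omega>, Y \<omega>))"
  shows indep_var_integral_decouple:
      "expectation (\<lambda>\<omega>. f (X \<omega>, Y \<omega>)) = (\<integral>\<omega>. (\<integral>\<omega>'. f (X \<omega>, Y \<omega>') \<partial>M) \<partial>M)"
    and indep_var_integrable_decouple: "integrable M (\<lambda>\<omega>. \<integral>\<omega>'. f (X \<omega>, Y \<omega>') \<partial>M)"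
proof -
  have X [measurable]: "X \<in> M \<rightarrow>\<^sub>M MX" and Y [measurable]: "Y \<in> M \<rightarrow>\<^sub>M MY"
    and eq: "distr M MX X \<Otimes>\<^sub>M distr M MY Y = distr M (MX \<Otimes>\<^sub>M MY) (\<lambda>x. (X x, Y x))"
    using indep by (auto simp: indep_var_distribution_eq)
  interpret X: prob_space "distr M MX X" by (rule prob_space_distr) fact
  interpret Y: prob_space "distr M MY Y" by (rule prob_space_distr) fact
  interpret XY: pair_prob_space "distr M MX X" "distr M MY Y" ..
  have int': "integrable (distr M MX X \<Otimes>\<^sub>M distr M MY Y) f"
    unfolding eq using int by (subst integrable_distr_eq) auto
  have meas: "(\<lambda>x. \<integral>y. f (x, y) \<partial>distr M MY Y) \<in> borel_measurable MX"
    using Y.borel_measurable_lebesgue_integral[of "\<lambda>x y. f (x, y)" MX] by simp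
  have inner: "(\<integral>y. f (X \<omega>, y) \<partial>distr M MY Y) = (\<integral>\<omega>'. f (X \<omega>, Y \<omega>') \<partial>M)" if "\<omega> \<in> space M" for \<omega>
    using that X by (intro integral_distr) (auto intro!: measurable_compose[OF _ f] measurable_Pair dest: measurable_space)
  have "expectation (\<lambda>\<omega>. f (X \<omega>, Y \<omega>)) = (\<integral>z. f z \<partial>(distr M MX X \<Otimes>\<^sub>M distr M MY Y))"
    unfolding eq by (subst integral_distr) auto
  also have "\<dots> = (\<integral>x. (\<integral>y. f (x, y) \<partial>distr M MY Y) \<partial>distr M MX X)"
    using XY.integral_fst'[OF int'] by simp
  also have "\<dots> = (\<integral>\<omega>. (\<integral>y. f (X \<omega>, y) \<partial>distr M MY Y) \<partial>M)"
    using meas by (subst integral_distr) auto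
  also have "\<dots> = (\<integral>\<omega>. (\<integral>\<omega>'. f (X \<omega>, Y \<omega>') \<partial>M) \<partial>M)"
    using inner by (intro Bochner_Integration.integral_cong) auto
  finally show "expectation (\<lambda>\<omega>. f (X \<omega>, Y \<omega>)) = (\<integral>\<omega>. (\<integral>\<omega>'. f (X \<omega>, Y \<omega>') \<partial>M) \<partial>M)" .
  have "integrable (distr M MX X) (\<lambda>x. \<integral>y. f (x, y) \<partial>distr M MY Y)"
    using XY.integrable_fst'[OF int'] .
  then have "integrable M (\<lambda>\<omega>. \<integral>y. f (X \<omega>, y) \<partial>distr M MY Y)"
    using meas by (subst (asm) integrable_distr_eq) auto
  then show "integrable M (\<lambda>\<omega>. \<integral>\<omega>'. f (X \<omega>, Y \<omega>') \<partial>M)"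
    using inner by (subst Bochner_Integration.integrable_cong[OF refl, of _ _ "\<lambda>\<omega>. \<integral>y. f (X \<omega>, y) \<partial>distr M MY Y"]) auto
qed

lemma char_distr_diff_le:
  assumes [measurable]: "Y \<in> borel_measurable M" "Z \<in> borel_measurable M"
    and int: "integrable M (\<lambda>\<omega>. Y \<omega> - Z \<omega>)"
  shows "cmod (char (distr M borel Y) u - char (distr M borel Z) u)
    \<le> \<bar>u\<bar> * expectation (\<lambda>\<omega>. \<bar>Y \<omega> - Z \<omega>\<bar>)"
proof -
  have iexp: "integrable M (\<lambda>\<omega>. iexp (u * Y \<omega>))" "integrable M (\<lambda>\<omega>. iexp (u * Z \<omega>))"
    by (auto intro!: integrable_const_bound[of _ 1])
  have "char (distr M borel Y) u - char (distr M borel Z) u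
      = (CLINT \<omega>|M. iexp (u * Y \<omega>) - iexp (u * Z \<omega>))"
    unfolding char_def using iexp by (simp add: integral_distr)
  also have "cmod \<dots> \<le> expectation (\<lambda>\<omega>. cmod (iexp (u * Y \<omega>) - iexp (u * Z \<omega>)))"
    by (rule integral_norm_bound)
  also have "\<dots> \<le> expectation (\<lambda>\<omega>. \<bar>u\<bar> * \<bar>Y \<omega> - Z \<omega>\<bar>)"
  proof (rule integral_mono)
    fix \<omega>
    have "iexp (u * Y \<omega>) - iexp (u * Z \<omega>) = iexp (u * Z \<omega>) * (iexp (u * (Y \<omega> - Z \<omega>)) - 1)"
      by (simp add: algebra_simps flip: exp_add)
    also have "cmod \<dots> = cmod (iexp (u * (Y \<omega> - Z \<omega>)) - 1)"
      by (simp add: norm_mult)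
    also have "\<dots> \<le> \<bar>u * (Y \<omega> - Z \<omega>)\<bar>"
      using iexp_approx1[of "u * (Y \<omega> - Z \<omega>)" 0] by simp
    finally show "cmod (iexp (u * Y \<omega>) - iexp (u * Z \<omega>)) \<le> \<bar>u\<bar> * \<bar>Y \<omega> - Z \<omega>\<bar>"
      by (simp add: abs_mult)
  qed (use iexp int in auto)
  finally show ?thesis by simp
qed

end

section \<open>The limiting normal law\<close>

lemma real_distribution_normal_law: "real_distribution (normal_law v)"
proof -
  interpret prob_space std_normal_distribution
    using real_dist_normal_dist by (rule real_distribution.axioms)
  show ?thesis unfolding normal_law_def by (rule real_distribution_distr) simp
qed

text \<open>Scaling by \<open>sqrt v\<close> evaluates the standard normal characteristic function
  at u \<open>sqrt v\<close>. The case v = 0 is included; it occurs in the limit when all \<sigma>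
  equal one constant.\<close>

lemma char_normal_law:
  assumes "0 \<le> v"
  shows "char (normal_law v) u = exp (- (u\<^sup>2 * v / 2))"
proof -
  have "char (normal_law v) u = char std_normal_distribution (u * sqrt v)"
    unfolding normal_law_def char_def by (subst integral_distr) (auto simp: ac_simps)
  then show ?thesis
    using assms by (simp add: char_std_normal_distribution power_mult_distrib)
qed

section \<open>The exact decomposition of CD\<close>

lemma sum_rotate_innermost:
  fixes f :: "nat \<Rightarrow> nat \<Rightarrow> nat \<Rightarrow> real"
  shows "(\<Sum>i<N. \<Sum>j<i. \<Sum>t<T. f i j t) = (\<Sum>t<T. \<Sum>i<N. \<Sum>j<i. f i j t)"
proof -
  have "(\<Sum>i<N. \<Sum>j<i. \<Sum>t<T. f i j t) = (\<Sum>i<N. \<Sum>t<T. \<Sum>j<i. f i j t)"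
    by (intro sum.cong refl sum.swap)
  also have "\<dots> = (\<Sum>t<T. \<Sum>i<N. \<Sum>j<i. f i j t)"
    by (rule sum.swap)
  finally show ?thesis .
qed

definition cd_scale :: "nat \<Rightarrow> nat \<Rightarrow> real" where
  "cd_scale N T = sqrt (2 / (real T * real N * (real N - 1)))"

text \<open>For nonzero \<open>s i\<close> this is \<open>s i\<close> times the deviation of
  \<open>1 / s i\<close> from its mean, so the weighted standardized error is the factor that occurs
  in \<open>Lead\<close>.\<close>

definition weight :: "nat \<Rightarrow> (nat \<Rightarrow> real) \<Rightarrow> nat \<Rightarrow> real" where
  "weight N s i = 1 - (\<Sum>k<N. 1 / s k) / real N * s i"

definition pairform :: "nat \<Rightarrow> (nat \<Rightarrow> real) \<Rightarrow> (nat \<Rightarrow> real) \<Rightarrow> real" where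
  "pairform N b e = (\<Sum>i<N. \<Sum>j<i. (b i * e i) * (b j * e j))"

text \<open>With z_i = e_i - eb / s_i, the pair sum is half of the square of the sum minus the sum
  of squares. The sum of the z_i is already the weighted sum of the e_i; the sum of squares yields
  the diagonal of the weighted form, the bias term and the terms containing eb.\<close>

lemma cd_pair_identity:
  fixes s e :: "nat \<Rightarrow> real"
  assumes s: "\<And>i. i < N \<Longrightarrow> s i \<noteq> 0" and N: "N > 0"
  defines "a \<equiv> (\<Sum>k<N. 1 / s k) / real N" and "eb \<equiv> (\<Sum>k<N. s k * e k) / real N"
  shows "(\<Sum>i<N. \<Sum>j<i. (s i * e i - eb) * (s j * e j - eb) / (s i * s j))
    = pairform N (weight N s) e
      + (\<Sum>i<N. (s i * e i)\<^sup>2 * (a\<^sup>2 - 2 * a * (1 / s i))) / 2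
      + (2 * eb * (\<Sum>i<N. e i / s i) - eb\<^sup>2 * (\<Sum>i<N. 1 / (s i)\<^sup>2)) / 2"
proof -
  define z where "z i = e i - eb / s i" for i
  have "(\<Sum>i<N. \<Sum>j<i. (s i * e i - eb) * (s j * e j - eb) / (s i * s j)) = (\<Sum>i<N. \<Sum>j<i. z i * z j)"
  proof (intro sum.cong refl)
    fix i j assume "i \<in> {..<N}" "j \<in> {..<i}"
    then have "s i \<noteq> 0" "s j \<noteq> 0" using s by auto
    then show "(s i * e i - eb) * (s j * e j - eb) / (s i * s j) = z i * z j"
      by (simp add: z_def field_simps)
  qed
  also have "\<dots> = ((\<Sum>i<N. z i)\<^sup>2 - (\<Sum>i<N. (z i)\<^sup>2)) / 2"
    by (rule sum_pairs_eq)
  also have "(\<Sum>i<N. z i) = (\<Sum>i<N. weight N s i * e i)"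
  proof -
    have "(\<Sum>i<N. z i) = (\<Sum>i<N. e i) - eb * (\<Sum>i<N. 1 / s i)"
      by (simp add: z_def sum_subtractf sum_distrib_left)
    \<comment> \<open>The division by N moves from one sum to the other: both sides are 1/N times
      the product of the same two sums.\<close>
    also have "eb * (\<Sum>i<N. 1 / s i) = a * (\<Sum>i<N. s i * e i)"
      using N by (simp add: a_def eb_def)
    finally show ?thesis
      by (simp add: weight_def sum_subtractf sum_distrib_left algebra_simps flip: a_def)
  qed
  also have "(\<Sum>i<N. (z i)\<^sup>2) = (\<Sum>i<N. (e i)\<^sup>2) - 2 * eb * (\<Sum>i<N. e i / s i) + eb\<^sup>2 * (\<Sum>i<N. 1 / (s i)\<^sup>2)"
    by (simp add: z_def power2_diff sum.distrib sum_subtractf sum_distrib_left power_divide ac_simps)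
  \<comment> \<open>The diagonal must carry the weights for \<open>pairform\<close> to appear. The
    correction is the summand of \<open>Xi\<close>, because the squared weight minus 1 equals a^2
    s_i^2 - 2 a s_i.\<close>
  also have "(\<Sum>i<N. (e i)\<^sup>2) = (\<Sum>i<N. (weight N s i * e i)\<^sup>2) - (\<Sum>i<N. (s i * e i)\<^sup>2 * (a\<^sup>2 - 2 * a * (1 / s i)))"
    unfolding sum_subtractf[symmetric]
  proof (intro sum.cong refl)
    fix i assume "i \<in> {..<N}"
    then have "s i \<noteq> 0" using s by auto
    then show "(e i)\<^sup>2 = (weight N s i * e i)\<^sup>2 - (s i * e i)\<^sup>2 * (a\<^sup>2 - 2 * a * (1 / s i))"
      unfolding weight_def a_def[symmetric]
      by (simp add: power2_eq_square field_simps)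
  qed
  also have "((\<Sum>i<N. weight N s i * e i)\<^sup>2 - (((\<Sum>i<N. (weight N s i * e i)\<^sup>2)
        - (\<Sum>i<N. (s i * e i)\<^sup>2 * (a\<^sup>2 - 2 * a * (1 / s i)))) - 2 * eb * (\<Sum>i<N. e i / s i)
        + eb\<^sup>2 * (\<Sum>i<N. 1 / (s i)\<^sup>2))) / 2
     = ((\<Sum>i<N. weight N s i * e i)\<^sup>2 - (\<Sum>i<N. (weight N s i * e i)\<^sup>2)) / 2
      + (\<Sum>i<N. (s i * e i)\<^sup>2 * (a\<^sup>2 - 2 * a * (1 / s i))) / 2
      + (2 * eb * (\<Sum>i<N. e i / s i) - eb\<^sup>2 * (\<Sum>i<N. 1 / (s i)\<^sup>2)) / 2"
    by (simp add: field_simps)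
  also have "((\<Sum>i<N. weight N s i * e i)\<^sup>2 - (\<Sum>i<N. (weight N s i * e i)\<^sup>2)) / 2 = pairform N (weight N s) e"
    unfolding pairform_def by (rule sum_pairs_eq[symmetric])
  finally show ?thesis .
qed

definition remainder :: "nat \<Rightarrow> nat \<Rightarrow> (nat \<Rightarrow> real) \<Rightarrow> (nat \<Rightarrow> nat \<Rightarrow> real) \<Rightarrow> real" where
  "remainder N T s e = cd_scale N T / 2 * (\<Sum>t<T.
     2 * ((\<Sum>k<N. s k * e k t) / real N) * (\<Sum>i<N. e i t / s i)
     - ((\<Sum>k<N. s k * e k t) / real N)\<^sup>2 * (\<Sum>i<N. 1 / (s i)\<^sup>2))"

text \<open>Both sides are nonnegative and have the same square. The half on the right is the one
  that \<open>cd_pair_identity\<close> puts on the diagonal terms.\<close>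

lemma cd_scale_Xi:
  assumes "N \<ge> 2" "T \<ge> 1"
  shows "sqrt (real T) * (sqrt (real N / (2 * (real N - 1))) * (1 / (real N * real T))) = cd_scale N T / 2"
proof (rule power2_eq_imp_eq)
  show "(sqrt (real T) * (sqrt (real N / (2 * (real N - 1))) * (1 / (real N * real T))))\<^sup>2 = (cd_scale N T / 2)\<^sup>2"
    using assms by (simp add: cd_scale_def power_mult_distrib power_divide) (simp add: field_simps power2_eq_square)
qed (use assms in \<open>auto simp: cd_scale_def\<close>)

lemma Lead_eq:
  assumes "\<And>i. i < N \<Longrightarrow> sg i \<omega> \<noteq> 0"
  shows "Lead sg eta N T \<omega>
    = cd_scale N T * (\<Sum>t<T. pairform N (weight N (\<lambda>i. sg i \<omega>)) (\<lambda>i. eta i t \<omega>))"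
proof -
  have "eps sg eta i t \<omega> * eps sg eta j t \<omega> * (1 / sg i \<omega> - sbar_inv sg N \<omega>) * (1 / sg j \<omega> - sbar_inv sg N \<omega>)
    = weight N (\<lambda>i. sg i \<omega>) i * eta i t \<omega> * (weight N (\<lambda>i. sg i \<omega>) j * eta j t \<omega>)"
    if "i < N" "j < i" for i j t
  proof -
    have "sg i \<omega> \<noteq> 0" "sg j \<omega> \<noteq> 0" using assms that by auto
    then show ?thesis
      unfolding weight_def eps_def sbar_inv_def[symmetric] by (simp add: field_simps)
  qed
  then show ?thesis
    unfolding Lead_def sum_rotate_innermost pairform_def cd_scale_def by simp
qed

lemma CD_decomposition:
  assumes s: "\<And>i. i < N \<Longrightarrow> sg i \<omega> \<noteq> 0" and N: "N \<ge> 2" and T: "T \<ge> 1"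
  shows "CD tau sg eta N T \<omega> = Lead sg eta N T \<omega> + sqrt (real T) * Xi sg eta N T \<omega>
    + remainder N T (\<lambda>i. sg i \<omega>) (\<lambda>i t. eta i t \<omega>)"
proof -
  let ?s = "\<lambda>i. sg i \<omega>"
  define eb where "eb t = (\<Sum>k<N. sg k \<omega> * eta k t \<omega>) / real N" for t
  \<comment> \<open>The time effect \<open>tau t\<close> cancels against its copy in the
    cross-sectional average, so it drops out of \<open>CD\<close>.\<close>
  have resid: "resid tau sg eta N i t \<omega> = sg i \<omega> * eta i t \<omega> - eb t" for i t
    using N by (simp add: resid_def tauhat_def yobs_def eps_def eb_def sum.distrib add_divide_distrib)
  have "CD tau sg eta N T \<omega> = cd_scale N T * (\<Sum>t<T. \<Sum>i<N. \<Sum>j<i.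
      (sg i \<omega> * eta i t \<omega> - eb t) * (sg j \<omega> * eta j t \<omega> - eb t) / (sg i \<omega> * sg j \<omega>))"
    unfolding CD_def sum_rotate_innermost resid cd_scale_def ..
  also have "\<dots> = cd_scale N T * (\<Sum>t<T. pairform N (weight N ?s) (\<lambda>i. eta i t \<omega>)
      + (\<Sum>i<N. (sg i \<omega> * eta i t \<omega>)\<^sup>2 * ((sbar_inv sg N \<omega>)\<^sup>2 - 2 * sbar_inv sg N \<omega> * (1 / sg i \<omega>))) / 2
      + (2 * eb t * (\<Sum>i<N. eta i t \<omega> / sg i \<omega>) - (eb t)\<^sup>2 * (\<Sum>i<N. 1 / (sg i \<omega>)\<^sup>2)) / 2)"
    unfolding sbar_inv_def eb_def
    using N s by (intro arg_cong2[where f="(*)"] refl sum.cong cd_pair_identity) auto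
  also have "\<dots> = Lead sg eta N T \<omega>
      + cd_scale N T / 2 * (\<Sum>t<T. \<Sum>i<N. (sg i \<omega> * eta i t \<omega>)\<^sup>2 * ((sbar_inv sg N \<omega>)\<^sup>2 - 2 * sbar_inv sg N \<omega> * (1 / sg i \<omega>)))
      + remainder N T ?s (\<lambda>i t. eta i t \<omega>)"
    unfolding remainder_def eb_def[symmetric]
    using Lead_eq[of N sg \<omega> eta T, OF s]
    by (simp add: sum.distrib distrib_left flip: sum_divide_distrib)
  also have "(\<Sum>t<T. \<Sum>i<N. (sg i \<omega> * eta i t \<omega>)\<^sup>2 * ((sbar_inv sg N \<omega>)\<^sup>2 - 2 * sbar_inv sg N \<omega> * (1 / sg i \<omega>)))
     = (\<Sum>i<N. \<Sum>t<T. (eps sg eta i t \<omega>)\<^sup>2 * ((sbar_inv sg N \<omega>)\<^sup>2 - 2 * sbar_inv sg N \<omega> * (1 / sg i \<omega>)))"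
    unfolding eps_def by (rule sum.swap)
  also have "cd_scale N T / 2 * \<dots> = sqrt (real T) * Xi sg eta N T \<omega>"
    unfolding Xi_def cd_scale_Xi[OF N T, symmetric] by (simp only: mult.assoc)
  finally show ?thesis .
qed

section \<open>Size of the normalizing factor and of the remainder\<close>

lemma cd_scale_le:
  assumes "N \<ge> 2" "T \<ge> 1"
  shows "cd_scale N T \<le> 2 / (real N * sqrt (real T))"
proof -
  \<comment> \<open>For N at least 2, N - 1 is at least N / 2.\<close>
  have "2 / (real T * real N * (real N - 1)) \<le> 4 / (real T * real N * real N)"
    using assms by (simp add: field_simps)
  then have "cd_scale N T \<le> sqrt (4 / (real T * real N * real N))"
    unfolding cd_scale_def by (rule real_sqrt_le_mono)
  also have "\<dots> = 2 / (real N * sqrt (real T))"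
    using assms by (simp add: real_sqrt_divide real_sqrt_mult)
  finally show ?thesis .
qed

lemma cd_scale_nonneg: "0 \<le> cd_scale N T"
  by (cases N) (auto simp: cd_scale_def)

text \<open>The product of the two sums is split by |2 x h| \<le> x^2 + h^2, and the sum of the 1 /
  s_i^2 is at most N / d^2. Only squares of weighted sums divided by N are left, and these have
  bounded mean in each period.\<close>

lemma abs_remainder_le:
  assumes N: "N > 0" and s: "\<And>i. i < N \<Longrightarrow> d \<le> s i" and d: "0 < d"
  shows "\<bar>remainder N T s e\<bar> \<le> cd_scale N T / 2 * (\<Sum>t<T.
     (1 + 1 / d\<^sup>2) * ((\<Sum>k<N. s k * e k t)\<^sup>2 / real N) + (\<Sum>i<N. 1 / s i * e i t)\<^sup>2 / real N)"
proof -
  have "\<bar>remainder N T s e\<bar> \<le> cd_scale N T / 2 * \<bar>\<Sum>t<T.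
     2 * ((\<Sum>k<N. s k * e k t) / real N) * (\<Sum>i<N. e i t / s i)
     - ((\<Sum>k<N. s k * e k t) / real N)\<^sup>2 * (\<Sum>i<N. 1 / (s i)\<^sup>2)\<bar>"
    by (simp add: remainder_def abs_mult cd_scale_nonneg)
  also have "\<dots> \<le> cd_scale N T / 2 * (\<Sum>t<T.
     (1 + 1 / d\<^sup>2) * ((\<Sum>k<N. s k * e k t)\<^sup>2 / real N) + (\<Sum>i<N. 1 / s i * e i t)\<^sup>2 / real N)"
  proof (intro mult_left_mono order_trans[OF sum_abs sum_mono])
    fix t
    define x where "x = (\<Sum>k<N. s k * e k t)"
    define h where "h = (\<Sum>i<N. 1 / s i * e i t)"
    define P where "P = (\<Sum>i<N. 1 / (s i)\<^sup>2)"
    have "P \<le> (\<Sum>i<N. 1 / d\<^sup>2)"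
      unfolding P_def using s d by (intro sum_mono divide_left_mono power_mono) (auto intro!: mult_pos_pos zero_less_power dest: order_less_le_trans[OF d])
    then have P: "0 \<le> P" "P \<le> real N / d\<^sup>2" by (auto simp: P_def intro!: sum_nonneg)
    have "\<bar>2 * x * h\<bar> \<le> x\<^sup>2 + h\<^sup>2"
      using zero_le_power2[of "\<bar>x\<bar> - \<bar>h\<bar>"] by (simp add: power2_diff abs_mult)
    then have 1: "\<bar>2 * (x / real N) * h\<bar> \<le> x\<^sup>2 / real N + h\<^sup>2 / real N"
      using N by (simp add: abs_mult field_simps)
    have "(x / real N)\<^sup>2 * P \<le> (x / real N)\<^sup>2 * (real N / d\<^sup>2)"
      using P by (intro mult_left_mono) auto
    also have "\<dots> = 1 / d\<^sup>2 * (x\<^sup>2 / real N)"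
      using N by (simp add: power2_eq_square field_simps)
    finally have 2: "\<bar>(x / real N)\<^sup>2 * P\<bar> \<le> 1 / d\<^sup>2 * (x\<^sup>2 / real N)"
      using P by (simp add: abs_mult)
    have "\<bar>2 * (x / real N) * h - (x / real N)\<^sup>2 * P\<bar> \<le> (1 + 1 / d\<^sup>2) * (x\<^sup>2 / real N) + h\<^sup>2 / real N"
      using order_trans[OF abs_triangle_ineq4 add_mono[OF 1 2]] by (simp add: algebra_simps)
    then show "\<bar>2 * ((\<Sum>k<N. s k * e k t) / real N) * (\<Sum>i<N. e i t / s i)
     - ((\<Sum>k<N. s k * e k t) / real N)\<^sup>2 * (\<Sum>i<N. 1 / (s i)\<^sup>2)\<bar>
      \<le> (1 + 1 / d\<^sup>2) * ((\<Sum>k<N. s k * e k t)\<^sup>2 / real N) + (\<Sum>i<N. 1 / s i * e i t)\<^sup>2 / real N"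
      by (simp add: x_def h_def P_def)
  qed (simp add: cd_scale_nonneg)
  finally show ?thesis .
qed

section \<open>Concentration of the conditional variance\<close>

text \<open>A law of large numbers in mean: the centered variables are bounded by 2 W, so their
  average has second moment at most 4 W^2 / n, and Young's inequality converts this into a
  first-moment bound.\<close>

lemma (in prob_space) mean_abs_deviation_le:
  fixes Y :: "nat \<Rightarrow> 'a \<Rightarrow> real"
  assumes indep: "indep_vars (\<lambda>_. borel) Y UNIV"
    and bd: "\<And>i \<omega>. \<omega> \<in> space M \<Longrightarrow> \<bar>Y i \<omega>\<bar> \<le> W"
    and mean: "\<And>i. expectation (Y i) = \<mu>"
    and n: "n > 0"
  shows "expectation (\<lambda>\<omega>. \<bar>(\<Sum>i<n. Y i \<omega>) / real n - \<mu>\<bar>) \<le> (4 * W\<^sup>2 + 1) / 2 / sqrt (real n)"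
proof -
  have [measurable]: "Y i \<in> borel_measurable M" for i
    using indep by (auto simp: indep_vars_def)
  have int: "integrable M (Y i)" for i
    using bd by (intro integrable_const_bound[of _ W]) auto
  have W: "0 \<le> W"
    using not_empty bd[of _ 0] abs_ge_zero order_trans by blast
  have \<mu>: "\<bar>\<mu>\<bar> \<le> W"
  proof -
    have "\<bar>expectation (Y 0)\<bar> \<le> expectation (\<lambda>\<omega>. \<bar>Y 0 \<omega>\<bar>)" by (rule integral_abs_bound)
    also have "\<dots> \<le> W" using int bd by (intro integral_le_const) auto
    finally show ?thesis using mean by simp
  qed
  define X where "X i \<omega> = Y i \<omega> - \<mu>" for i \<omega>
  have bdX: "\<bar>X i \<omega>\<bar> \<le> 2 * W" if "\<omega> \<in> space M" for i \<omega>
    using bd[OF that, of i] \<mu> by (auto simp: X_def)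
  have X_meas [measurable]: "X i \<in> borel_measurable M" for i
    unfolding X_def[abs_def] by measurable
  have int_pow: "integrable M (\<lambda>\<omega>. X i \<omega> ^ k)" for i k
  proof (intro integrable_const_bound[of _ "(2 * W) ^ k"] AE_I2)
    show "norm (X i \<omega> ^ k) \<le> (2 * W) ^ k" if "\<omega> \<in> space M" for \<omega>
      unfolding real_norm_def power_abs using bdX[OF that] by (intro power_mono) auto
  qed simp
  have pow_le: "expectation (\<lambda>\<omega>. X i \<omega> ^ k) \<le> (2 * W) ^ k" for i k
  proof (rule integral_le_const[OF int_pow])
    have "X i \<omega> ^ k \<le> (2 * W) ^ k" if "\<omega> \<in> space M" for \<omega>
    proof -
      have "X i \<omega> ^ k \<le> \<bar>X i \<omega> ^ k\<bar>" by simp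
      also have "\<dots> \<le> (2 * W) ^ k" unfolding power_abs using bdX[OF that] by (intro power_mono) auto
      finally show ?thesis .
    qed
    then show "AE \<omega> in M. X i \<omega> ^ k \<le> (2 * W) ^ k" by auto
  qed
  interpret centered_indep_seq M X "(2 * W) ^ 6"
  proof
    show "indep_vars (\<lambda>_. borel) X UNIV"
      unfolding X_def[abs_def] using indep by (rule indep_vars_compose2) auto
    show "expectation (X i) = 0" for i
      using int mean by (simp add: X_def[abs_def] prob_space)
  qed (rule int_pow pow_le)+
  define Z where "Z \<omega> = (\<Sum>i<n. Y i \<omega>) / real n - \<mu>" for \<omega>
  have Z: "Z \<omega> = S n \<omega> / real n" for \<omega>
    using n by (simp add: Z_def S_def X_def sum_subtractf field_simps)
  \<comment> \<open>This r balances the two terms of Young's inequality: r times a second moment of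
    order 1/n, and 1/r.\<close>
  define r where "r = sqrt (real n)"
  have r: "r > 0" "r * r = real n" using n by (auto simp: r_def)
  have young: "\<bar>z\<bar> \<le> (r * z\<^sup>2 + 1 / r) / 2" for z
  proof -
    have "0 \<le> (r * \<bar>z\<bar> - 1)\<^sup>2 / r" using r by simp
    also have "\<dots> = r * z\<^sup>2 + 1 / r - 2 * \<bar>z\<bar>"
      using r by (simp add: power2_diff field_simps power2_eq_square)
    finally show ?thesis by simp
  qed
  have intZ: "integrable M (\<lambda>\<omega>. (Z \<omega>)\<^sup>2)" "integrable M Z"
    unfolding Z[abs_def] power_divide using int_S[of 2 n] int_S[of 1 n] by auto
  have "expectation (\<lambda>\<omega>. \<bar>Z \<omega>\<bar>) \<le> expectation (\<lambda>\<omega>. (r * (Z \<omega>)\<^sup>2 + 1 / r) / 2)"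
    using intZ young by (intro integral_mono) auto
  also have "\<dots> = (r * expectation (\<lambda>\<omega>. (Z \<omega>)\<^sup>2) + 1 / r) / 2"
    using intZ by (simp add: prob_space)
  also have "expectation (\<lambda>\<omega>. (Z \<omega>)\<^sup>2) = (\<Sum>i<n. expectation (\<lambda>\<omega>. (X i \<omega>)\<^sup>2)) / (real n)\<^sup>2"
    unfolding Z power_divide second_moment_S[symmetric] by simp
  also have "\<dots> \<le> (\<Sum>i<n. (2 * W)\<^sup>2) / (real n)\<^sup>2"
    by (intro divide_right_mono sum_mono pow_le) auto
  also have "\<dots> = 4 * W\<^sup>2 / real n"
    using n by (simp add: power2_eq_square)
  also have "(r * (4 * W\<^sup>2 / real n) + 1 / r) / 2 = (4 * W\<^sup>2 + 1) / 2 / r"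
    using r by (simp add: field_simps flip: r(2))
  finally show ?thesis
    using r by (simp add: Z_def r_def)
qed

text \<open>The variance of \<open>cd_scale N T * (\<Sum>t<T. pairform N b (\<lambda>i. \<eta> i t))\<close>
  for deterministic \<open>b\<close> and i.i.d. standardized \<open>\<eta>\<close>.\<close>

definition pair_variance :: "nat \<Rightarrow> (nat \<Rightarrow> real) \<Rightarrow> real" where
  "pair_variance N b = 2 / (real N * (real N - 1)) * (\<Sum>i<N. \<Sum>j<i. (b i)\<^sup>2 * (b j)\<^sup>2)"

lemma pair_variance_nonneg: "N \<ge> 1 \<Longrightarrow> 0 \<le> pair_variance N b"
  unfolding pair_variance_def by (intro mult_nonneg_nonneg divide_nonneg_nonneg sum_nonneg) auto

text \<open>With p the sum of the b_i^2 and q the sum of the b_i^4, the pair sum is (p^2 - q) / 2.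
  The difference is then (p^2 / N - q) / (N (N - 1)): it comes from the missing diagonal and from N
  - 1 in place of N.\<close>

lemma pair_variance_approx:
  assumes N: "N \<ge> 2" and b: "\<And>i. i < N \<Longrightarrow> \<bar>b i\<bar> \<le> B"
  shows "\<bar>pair_variance N b - ((\<Sum>i<N. (b i)\<^sup>2) / real N)\<^sup>2\<bar> \<le> 2 * B ^ 4 / real N"
proof -
  define n where "n = real N"
  define p where "p = (\<Sum>i<N. (b i)\<^sup>2)"
  define q where "q = (\<Sum>i<N. (b i) ^ 4)"
  have n: "n \<ge> 2" using N by (simp add: n_def)
  have b2: "(b i)\<^sup>2 \<le> B\<^sup>2" if "i < N" for i
    using power_mono[OF b[OF that], of 2] by simp
  have b4: "(b i) ^ 4 \<le> B ^ 4" if "i < N" for i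
    using power_mono[OF b[OF that], of 4] by (simp add: power_even_abs)
  have p: "0 \<le> p" "p \<le> n * B\<^sup>2"
    using sum_mono[of "{..<N}" "\<lambda>i. (b i)\<^sup>2" "\<lambda>_. B\<^sup>2"] b2 by (auto simp: p_def n_def sum_nonneg)
  have q: "0 \<le> q" "q \<le> n * B ^ 4"
    using sum_mono[of "{..<N}" "\<lambda>i. b i ^ 4" "\<lambda>_. B ^ 4"] b4 by (auto simp: q_def n_def sum_nonneg zero_le_even_power)
  have "(p\<^sup>2) \<le> (n * B\<^sup>2)\<^sup>2" using p by (intro power_mono) auto
  then have p2: "p\<^sup>2 / n \<le> n * B ^ 4" using n by (simp add: field_simps power_mult_distrib power2_eq_square eval_nat_numeral)
  have V: "pair_variance N b = 2 / (n * (n - 1)) * ((p\<^sup>2 - q) / 2)"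
    unfolding pair_variance_def sum_pairs_eq p_def q_def n_def by simp
  have "pair_variance N b - (p / n)\<^sup>2 = (p\<^sup>2 / n - q) / (n * (n - 1))"
    unfolding V using n by (simp add: field_simps power2_eq_square)
  also have "\<bar>\<dots>\<bar> = \<bar>p\<^sup>2 / n - q\<bar> / (n * (n - 1))"
    using n by (simp add: abs_divide)
  also have "\<dots> \<le> (n * B ^ 4) / (n * (n - 1))"
  proof (rule divide_right_mono)
    have "0 \<le> p\<^sup>2 / n" using n by simp
    \<comment> \<open>Both p^2 / n and q lie between 0 and n B^4, so their difference is bounded by
      n B^4 and not by its double.\<close>
    with p2 q show "\<bar>p\<^sup>2 / n - q\<bar> \<le> n * B ^ 4" unfolding abs_le_iff by linarith
  qed (use n in simp)
  also have "\<dots> = B ^ 4 / (n - 1)" using n by simp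
  also have "\<dots> \<le> 2 * B ^ 4 / n"
  proof -
    have "B ^ 4 * n \<le> B ^ 4 * (2 * (n - 1))" using n by (intro mult_left_mono) (auto simp: zero_le_even_power)
    then show ?thesis using n by (simp add: field_simps)
  qed
  finally show ?thesis by (simp add: p_def n_def)
qed

section \<open>Weights in terms of sample means\<close>

lemma abs_mean_le:
  fixes g :: "nat \<Rightarrow> real"
  assumes "N > 0" "\<And>i. i < N \<Longrightarrow> \<bar>g i\<bar> \<le> W"
  shows "\<bar>(\<Sum>i<N. g i) / real N\<bar> \<le> W"
proof -
  have "\<bar>\<Sum>i<N. g i\<bar> \<le> (\<Sum>i<N. W)"
    using assms by (intro order_trans[OF sum_abs sum_mono]) auto
  then show ?thesis using assms by (simp add: field_simps)
qed

text \<open>The bound depends on neither N nor i, which makes the Gaussian approximation uniform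
  over the values of \<sigma> that are conditioned on.\<close>

lemma abs_weight_le:
  assumes "N > 0" "0 < d" "\<And>i. d \<le> s i \<and> s i \<le> c"
  shows "\<bar>weight N s i\<bar> \<le> 1 + c / d"
proof -
  have s: "0 < s i" for i using assms(2) assms(3)[of i] by linarith
  have "\<bar>1 / s k\<bar> \<le> 1 / d" for k
    using frac_le[of 1 1 d "s k"] s[of k] assms(2) assms(3)[of k] by simp
  then have "\<bar>(\<Sum>k<N. 1 / s k) / real N\<bar> \<le> 1 / d"
    using assms(1) by (intro abs_mean_le)
  then have "\<bar>(\<Sum>k<N. 1 / s k) / real N * s i\<bar> \<le> 1 / d * c"
    unfolding abs_mult using assms(2,3) s by (intro mult_mono) (auto simp: less_imp_le)
  also have "\<dots> = c / d" by simp
  finally show ?thesis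
    unfolding weight_def using abs_triangle_ineq4[of 1 "(\<Sum>k<N. 1 / s k) / real N * s i"] by linarith
qed

text \<open>Reduces the mean squared weight to a polynomial in three sample means, to which the law
  of large numbers applies.\<close>

lemma mean_weight_sq:
  assumes N: "N > 0"
  shows "(\<Sum>i<N. (weight N s i)\<^sup>2) / real N
    = 1 - 2 * ((\<Sum>i<N. 1 / s i) / real N) * ((\<Sum>i<N. s i) / real N)
      + ((\<Sum>i<N. 1 / s i) / real N)\<^sup>2 * ((\<Sum>i<N. (s i)\<^sup>2) / real N)"
proof -
  define a where "a = (\<Sum>i<N. 1 / s i) / real N"
  have "(\<Sum>i<N. (weight N s i)\<^sup>2) = real N - 2 * a * (\<Sum>i<N. s i) + a\<^sup>2 * (\<Sum>i<N. (s i)\<^sup>2)"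
    unfolding weight_def a_def[symmetric]
    by (simp add: power2_diff sum.distrib sum_subtractf sum_distrib_left power_mult_distrib ac_simps)
  then show ?thesis
    using N unfolding a_def[symmetric] by (simp add: add_divide_distrib diff_divide_distrib)
qed

text \<open>The arguments are exchanged one after another, each exchange costing the corresponding
  difference. It will be used with sample means for a, x, y and expectations for the primed
  variables.\<close>

lemma abs_poly_diff_le:
  fixes a x y a' x' y' c k :: real
  assumes "\<bar>a\<bar> \<le> k" "\<bar>a'\<bar> \<le> k" "\<bar>x\<bar> \<le> c" "\<bar>y\<bar> \<le> c\<^sup>2"
  shows "\<bar>(1 - 2 * a * x + a\<^sup>2 * y) - (1 - 2 * a' * x' + a'\<^sup>2 * y')\<bar>
    \<le> (2 * c + 2 * k * c\<^sup>2) * \<bar>a - a'\<bar> + 2 * k * \<bar>x - x'\<bar> + k\<^sup>2 * \<bar>y - y'\<bar>"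
proof -
  have k: "0 \<le> k" using assms(1) by linarith
  have "(1 - 2 * a * x + a\<^sup>2 * y) - (1 - 2 * a' * x' + a'\<^sup>2 * y')
    = - (2 * x * (a - a')) - 2 * a' * (x - x') + (a + a') * y * (a - a') + a'\<^sup>2 * (y - y')"
    by (simp add: algebra_simps power2_eq_square)
  also have "\<bar>\<dots>\<bar> \<le> \<bar>2 * x * (a - a')\<bar> + \<bar>2 * a' * (x - x')\<bar> + \<bar>(a + a') * y * (a - a')\<bar> + \<bar>a'\<^sup>2 * (y - y')\<bar>"
    by linarith
  also have "\<dots> \<le> (2 * c) * \<bar>a - a'\<bar> + (2 * k) * \<bar>x - x'\<bar> + (2 * k * c\<^sup>2) * \<bar>a - a'\<bar> + k\<^sup>2 * \<bar>y - y'\<bar>"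
    unfolding abs_mult
    using assms k power_mono[OF assms(2), of 2]
    by (intro add_mono mult_right_mono mult_mono) auto
  finally show ?thesis by (simp add: algebra_simps)
qed

section \<open>The panel model\<close>

text \<open>The sum type indexes both arrays, \<open>Inl (i, t)\<close> for \<open>eta\<close> and
  \<open>Inr i\<close> for \<open>sg\<close>, so one independence statement covers independence
  within each array and between them.\<close>

locale panel = prob_space M for M :: "'a measure" +
  fixes eta :: "nat \<Rightarrow> nat \<Rightarrow> 'a \<Rightarrow> real" and sg :: "nat \<Rightarrow> 'a \<Rightarrow> real" and \<delta> Mb :: real
  assumes indep: "indep_vars (\<lambda>_. borel) (\<lambda>k. case k of Inl (i, t) \<Rightarrow> eta i t | Inr i \<Rightarrow> sg i) UNIV"
    and eta_id: "\<And>i t. distr M borel (eta i t) = distr M borel (eta 0 0)"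
    and sigma_id: "\<And>i. distr M borel (sg i) = distr M borel (sg 0)"
    and eta_int6: "integrable M (\<lambda>\<omega>. (eta 0 0 \<omega>) ^ 6)"
    and eta_mean: "expectation (eta 0 0) = 0"
    and eta_var: "expectation (\<lambda>\<omega>. (eta 0 0 \<omega>)\<^sup>2) = 1"
    and delta_pos: "0 < \<delta>"
    and sigma_bd: "\<And>i \<omega>. \<omega> \<in> space M \<Longrightarrow> \<delta> \<le> sg i \<omega> \<and> sg i \<omega> \<le> Mb"
begin

section \<open>Measurability, moments and independent blocks of the model\<close>

lemma eta_meas [measurable]: "eta i t \<in> borel_measurable M"
  using indep by (auto simp: indep_vars_def split: sum.splits prod.splits)

lemma sg_meas [measurable]: "sg i \<in> borel_measurable M"
  using indep by (auto simp: indep_vars_def split: sum.splits prod.splits)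

lemma Mb_pos: "0 < Mb"
  using not_empty sigma_bd delta_pos by (meson all_not_in_conv less_le_trans)

lemma eta_transfer:
  fixes g :: "real \<Rightarrow> real"
  assumes [measurable]: "g \<in> borel_measurable borel"
  shows "expectation (\<lambda>\<omega>. g (eta i t \<omega>)) = expectation (\<lambda>\<omega>. g (eta 0 0 \<omega>))"
    and "integrable M (\<lambda>\<omega>. g (eta i t \<omega>)) \<longleftrightarrow> integrable M (\<lambda>\<omega>. g (eta 0 0 \<omega>))"
proof -
  have "expectation (\<lambda>\<omega>. g (eta i t \<omega>)) = integral\<^sup>L (distr M borel (eta i t)) g" for i t
    by (subst integral_distr) auto
  then show "expectation (\<lambda>\<omega>. g (eta i t \<omega>)) = expectation (\<lambda>\<omega>. g (eta 0 0 \<omega>))"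
    using eta_id by metis
  have "integrable M (\<lambda>\<omega>. g (eta i t \<omega>)) \<longleftrightarrow> integrable (distr M borel (eta i t)) g" for i t
    by (subst integrable_distr_eq) auto
  then show "integrable M (\<lambda>\<omega>. g (eta i t \<omega>)) \<longleftrightarrow> integrable M (\<lambda>\<omega>. g (eta 0 0 \<omega>))"
    using eta_id by metis
qed

lemma sg_transfer:
  fixes g :: "real \<Rightarrow> real"
  assumes [measurable]: "g \<in> borel_measurable borel"
  shows "expectation (\<lambda>\<omega>. g (sg i \<omega>)) = expectation (\<lambda>\<omega>. g (sg 0 \<omega>))"
proof -
  have "expectation (\<lambda>\<omega>. g (sg i \<omega>)) = integral\<^sup>L (distr M borel (sg i)) g" for i
    by (subst integral_distr) auto
  then show ?thesis using sigma_id by metis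
qed

lemma eta_int: "k \<le> 6 \<Longrightarrow> integrable M (\<lambda>\<omega>. eta i t \<omega> ^ k)"
  using integrable_power_le[OF _ eta_int6[THEN integrable_abs, unfolded power_abs], of k] eta_transfer(2)[of "\<lambda>x. x ^ k" i t] by auto

text \<open>The joint family is restricted to the disjoint singleton blocks \<open>{Inr i}\<close>
  and each block is read off at its coordinate. The same device gives
  \<open>indep_scaled_eta\<close> and \<open>indep_pairform\<close>.\<close>

lemma indep_sg:
  assumes [measurable]: "g \<in> borel_measurable borel"
  shows "indep_vars (\<lambda>_. borel) (\<lambda>i \<omega>. g (sg i \<omega>) :: real) UNIV"
proof -
  have 1: "indep_vars (\<lambda>i. PiM {Inr i :: (nat \<times> nat) + nat} (\<lambda>_. borel))
      (\<lambda>i \<omega>. restrict (\<lambda>k. (case k of Inl (i, t) \<Rightarrow> eta i t | Inr i \<Rightarrow> sg i) \<omega>) {Inr i}) UNIV"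
    by (rule indep_vars_restrict[OF indep]) (auto simp: disjoint_family_on_def)
  have "indep_vars (\<lambda>_. borel) (\<lambda>i \<omega>. (\<lambda>x. g (x (Inr i)))
      (restrict (\<lambda>k. (case k of Inl (i, t) \<Rightarrow> eta i t | Inr i \<Rightarrow> sg i) \<omega>) {Inr i})) UNIV"
    by (rule indep_vars_compose2[OF 1]) (rule measurable_compose[OF _ assms], rule measurable_component_singleton, simp)
  then show ?thesis by simp
qed

lemma indep_scaled_eta: "indep_vars (\<lambda>_. borel) (\<lambda>i \<omega>. b i * eta i t \<omega>) UNIV"
proof -
  have 1: "indep_vars (\<lambda>i. PiM {Inl (i, t) :: (nat \<times> nat) + nat} (\<lambda>_. borel))
      (\<lambda>i \<omega>. restrict (\<lambda>k. (case k of Inl (i, t) \<Rightarrow> eta i t | Inr i \<Rightarrow> sg i) \<omega>) {Inl (i, t)}) UNIV"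
    by (rule indep_vars_restrict[OF indep]) (auto simp: disjoint_family_on_def)
  have "indep_vars (\<lambda>_. borel) (\<lambda>i \<omega>. (\<lambda>x. b i * x (Inl (i, t)))
      (restrict (\<lambda>k. (case k of Inl (i, t) \<Rightarrow> eta i t | Inr i \<Rightarrow> sg i) \<omega>) {Inl (i, t)})) UNIV"
    by (rule indep_vars_compose2[OF 1])
       (intro borel_measurable_times borel_measurable_const measurable_component_singleton, simp)
  then show ?thesis by simp
qed

text \<open>The form of period t depends only on the block of all indices \<open>Inl (i, t)\<close>,
  and these blocks are disjoint for different t.\<close>

lemma indep_pairform: "indep_vars (\<lambda>_. borel) (\<lambda>t \<omega>. pairform N b (\<lambda>i. eta i t \<omega>)) UNIV"
proof -
  let ?K = "\<lambda>t. range (\<lambda>i. Inl (i, t) :: (nat \<times> nat) + nat)"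
  have 1: "indep_vars (\<lambda>t. PiM (?K t) (\<lambda>_. borel))
      (\<lambda>t \<omega>. restrict (\<lambda>k. (case k of Inl (i, t) \<Rightarrow> eta i t | Inr i \<Rightarrow> sg i) \<omega>) (?K t)) UNIV"
    by (rule indep_vars_restrict[OF indep]) (auto simp: disjoint_family_on_def)
  have "indep_vars (\<lambda>_. borel) (\<lambda>t \<omega>. (\<lambda>x. pairform N b (\<lambda>i. x (Inl (i, t))))
      (restrict (\<lambda>k. (case k of Inl (i, t) \<Rightarrow> eta i t | Inr i \<Rightarrow> sg i) \<omega>) (?K t))) UNIV"
    unfolding pairform_def
    by (rule indep_vars_compose2[OF 1])
       (intro borel_measurable_sum borel_measurable_times borel_measurable_const measurable_component_singleton, auto)
  then show ?thesis by simp
qed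

text \<open>The \<open>\<sigma>\<close> and \<open>\<eta>\<close> coordinates keep the joint index type since \<^const>\<open>prob_space.indep_var\<close>
  requires both variables to have values in the same type.\<close>

abbreviation sg_space :: "((nat \<times> nat) + nat \<Rightarrow> real) measure" where
  "sg_space \<equiv> PiM (range Inr) (\<lambda>_. borel)"

abbreviation eta_space :: "((nat \<times> nat) + nat \<Rightarrow> real) measure" where
  "eta_space \<equiv> PiM (range Inl) (\<lambda>_. borel)"

text \<open>Conditioning on \<sigma> in integrated form: the blocks \<open>range Inr\<close> and
  \<open>range Inl\<close> are independent, so \<open>eta\<close> may be read at a fresh point
  \<omega>' while \<open>sg\<close> stays frozen at \<omega>.\<close>

lemma
  fixes g :: "(nat \<Rightarrow> real) \<Rightarrow> (nat \<Rightarrow> nat \<Rightarrow> real) \<Rightarrow> 'd::{banach, second_countable_topology}"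
  assumes g: "(\<lambda>(x, y). g (\<lambda>i. x (Inr i)) (\<lambda>i t. y (Inl (i, t)))) \<in> borel_measurable (sg_space \<Otimes>\<^sub>M eta_space)"
    and int: "integrable M (\<lambda>\<omega>. g (\<lambda>i. sg i \<omega>) (\<lambda>i t. eta i t \<omega>))"
  shows decouple: "expectation (\<lambda>\<omega>. g (\<lambda>i. sg i \<omega>) (\<lambda>i t. eta i t \<omega>))
      = (\<integral>\<omega>. (\<integral>\<omega>'. g (\<lambda>i. sg i \<omega>) (\<lambda>i t. eta i t \<omega>') \<partial>M) \<partial>M)"
    and integrable_decouple: "integrable M (\<lambda>\<omega>. \<integral>\<omega>'. g (\<lambda>i. sg i \<omega>) (\<lambda>i t. eta i t \<omega>') \<partial>M)"
proof -
  let ?Z = "\<lambda>A \<omega>. restrict (\<lambda>k. (case k of Inl (i, t) \<Rightarrow> eta i t | Inr i \<Rightarrow> sg i) \<omega>) A"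
  have iv: "indep_var sg_space (?Z (range Inr)) eta_space (?Z (range Inl))"
    by (rule indep_var_restrict[OF indep]) auto
  note * = indep_var_integral_decouple[OF iv g] indep_var_integrable_decouple[OF iv g]
  show "expectation (\<lambda>\<omega>. g (\<lambda>i. sg i \<omega>) (\<lambda>i t. eta i t \<omega>))
      = (\<integral>\<omega>. (\<integral>\<omega>'. g (\<lambda>i. sg i \<omega>) (\<lambda>i t. eta i t \<omega>') \<partial>M) \<partial>M)"
    using *(1) int by simp
  show "integrable M (\<lambda>\<omega>. \<integral>\<omega>'. g (\<lambda>i. sg i \<omega>) (\<lambda>i t. eta i t \<omega>') \<partial>M)"
    using *(2) int by simp
qed

section \<open>Gaussian approximation for fixed weights\<close>

definition m6 :: real where "m6 = expectation (\<lambda>\<omega>. eta 0 0 \<omega> ^ 6)"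

lemma centered_scaled_eta:
  assumes b: "\<And>i. \<bar>b i\<bar> \<le> B"
  shows "centered_indep_seq M (\<lambda>i \<omega>. b i * eta i t \<omega>) (B ^ 6 * m6)"
proof
  show "indep_vars (\<lambda>_. borel) (\<lambda>i \<omega>. b i * eta i t \<omega>) UNIV" by (rule indep_scaled_eta)
  show "expectation (\<lambda>\<omega>. b i * eta i t \<omega>) = 0" for i
    using eta_transfer(1)[of "\<lambda>x. x" i t] eta_mean by simp
  show "integrable M (\<lambda>\<omega>. (b i * eta i t \<omega>) ^ 6)" for i
    using eta_int[of 6 i t] by (simp add: power_mult_distrib)
  show "expectation (\<lambda>\<omega>. (b i * eta i t \<omega>) ^ 6) \<le> B ^ 6 * m6" for i
  proof -
    have "expectation (\<lambda>\<omega>. (b i * eta i t \<omega>) ^ 6) = b i ^ 6 * m6"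
      using eta_transfer(1)[of "\<lambda>x. x ^ 6" i t] by (simp add: power_mult_distrib m6_def)
    moreover have "b i ^ 6 \<le> B ^ 6"
      using power_mono[OF b[of i], of 6] by (simp add: power_even_abs)
    moreover have "0 \<le> m6"
      unfolding m6_def by (intro integral_nonneg_AE) (auto simp: zero_le_even_power)
    ultimately show ?thesis by (simp add: mult_right_mono)
  qed
qed

lemma second_moment_scaled_eta: "expectation (\<lambda>\<omega>. (b i * eta i t \<omega>)\<^sup>2) = (b i)\<^sup>2"
  using eta_transfer(1)[of "\<lambda>x. x\<^sup>2" i t] eta_var by (simp add: power_mult_distrib)

text \<open>The T summands have third absolute moment at most K N^3 and the argument is of order 1 /
  (N sqrt T), so the cubic error T |w|^3 K N^3 is of order 1 / sqrt T. The powers of N cancel, which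
  leaves a bound depending on the weights only through B.\<close>

lemma char_pairform_approx:
  assumes N: "N \<ge> 2" and T: "T \<ge> 1" and b: "\<And>i. \<bar>b i\<bar> \<le> B"
  defines "K \<equiv> moment6_const (B ^ 6 * m6) + B ^ 6 * m6"
  shows "cmod (char (distr M borel (\<lambda>\<omega>. \<Sum>t<T. pairform N b (\<lambda>i. eta i t \<omega>))) (u * cd_scale N T)
      - exp (- (u\<^sup>2 * pair_variance N b / 2)))
    \<le> (4 / 3 * \<bar>u\<bar> ^ 3 * K + 2 * u ^ 4 * B ^ 8) / sqrt (real T)"
proof -
  interpret X: centered_indep_seq M "\<lambda>i \<omega>. b i * eta i t \<omega>" "B ^ 6 * m6" for t
    using b by (rule centered_scaled_eta)
  define v where "v = (\<Sum>i<N. \<Sum>j<i. (b i)\<^sup>2 * (b j)\<^sup>2)"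
  define w where "w = u * cd_scale N T"
  define r where "r = sqrt (real T)"
  have r: "r \<ge> 1" "real T = r * r" using T by (auto simp: r_def)
  have Q: "X.Q t N = (\<lambda>\<omega>. pairform N b (\<lambda>i. eta i t \<omega>))" for t
    by (simp add: X.Q_def[abs_def] pairform_def)
  have K: "0 \<le> K"
    unfolding K_def moment6_const_def using X.m_nonneg by (intro add_nonneg_nonneg zero_le_power) auto
  have v0: "0 \<le> v" by (auto simp: v_def intro!: sum_nonneg)
  have v1: "v \<le> (real N)\<^sup>2 * B ^ 4"
  proof -
    have b2: "(b i)\<^sup>2 \<le> B\<^sup>2" for i using power_mono[OF b[of i], of 2] by simp
    have "v \<le> (\<Sum>i<N. \<Sum>j<i. B\<^sup>2 * B\<^sup>2)"
      unfolding v_def by (intro sum_mono mult_mono b2) auto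
    also have "\<dots> \<le> (\<Sum>i<N. real N * (B\<^sup>2 * B\<^sup>2))"
      by (intro sum_mono) (auto intro!: mult_right_mono)
    finally show ?thesis by (simp add: power2_eq_square eval_nat_numeral)
  qed
  have "cmod (char (distr M borel (\<lambda>\<omega>. \<Sum>t<T. pairform N b (\<lambda>i. eta i t \<omega>))) w
      - exp (- (real T * (w\<^sup>2 * v / 2))))
    \<le> real T * (\<bar>w\<bar> ^ 3 * (K * real N ^ 3) / 6 + (w\<^sup>2 * v)\<^sup>2 / 8)"
  proof (rule char_sum_normal_approx)
    show "indep_vars (\<lambda>_. borel) (\<lambda>t \<omega>. pairform N b (\<lambda>i. eta i t \<omega>)) {..<T}"
      by (rule indep_vars_subset[OF indep_pairform]) simp
    show "integrable M (\<lambda>\<omega>. pairform N b (\<lambda>i. eta i t \<omega>))" for t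
      using X.int_Q[of 1 t N] by (simp add: Q)
    show "integrable M (\<lambda>\<omega>. (pairform N b (\<lambda>i. eta i t \<omega>))\<^sup>2)" for t
      using X.int_Q[of 2 t N] by (simp add: Q)
    show "integrable M (\<lambda>\<omega>. \<bar>pairform N b (\<lambda>i. eta i t \<omega>)\<bar> ^ 3)" for t
      using X.int3_Q[of t N] by (simp add: Q)
    show "expectation (\<lambda>\<omega>. pairform N b (\<lambda>i. eta i t \<omega>)) = 0" for t
      using X.mean_Q[of t N] by (simp add: Q)
    show "expectation (\<lambda>\<omega>. (pairform N b (\<lambda>i. eta i t \<omega>))\<^sup>2) = v" for t
      using X.second_moment_Q[of t N] unfolding Q second_moment_scaled_eta v_def .
    show "expectation (\<lambda>\<omega>. \<bar>pairform N b (\<lambda>i. eta i t \<omega>)\<bar> ^ 3) \<le> K * real N ^ 3" for t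
      using X.third_moment_Q[of t N] unfolding Q K_def .
  qed fact
  \<comment> \<open>The Gaussian exponent matches exactly; approximation is confined to the error
    term.\<close>
  also have "real T * (w\<^sup>2 * v / 2) = u\<^sup>2 * pair_variance N b / 2"
    using N T by (simp add: w_def cd_scale_def pair_variance_def power_mult_distrib v_def)
  also have "real T * (\<bar>w\<bar> ^ 3 * (K * real N ^ 3) / 6 + (w\<^sup>2 * v)\<^sup>2 / 8)
      \<le> (4 / 3 * \<bar>u\<bar> ^ 3 * K + 2 * u ^ 4 * B ^ 8) / r"
  proof -
    have w: "\<bar>w\<bar> \<le> 2 * \<bar>u\<bar> / (real N * r)"
      using mult_left_mono[OF cd_scale_le[OF N T], of "\<bar>u\<bar>"] cd_scale_nonneg[of N T]
      by (simp add: w_def abs_mult r_def mult.commute)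
    have Nr: "real N * r > 0" using N r by simp
    have "\<bar>w\<bar> ^ 3 * (K * real N ^ 3) / 6 \<le> (2 * \<bar>u\<bar> / (real N * r)) ^ 3 * (K * real N ^ 3) / 6"
      using w K by (intro divide_right_mono mult_right_mono power_mono) auto
    also have "\<dots> = 4 / 3 * \<bar>u\<bar> ^ 3 * K / r ^ 3"
      using N r by (simp add: power_divide power_mult_distrib)
    finally have 1: "\<bar>w\<bar> ^ 3 * (K * real N ^ 3) / 6 \<le> 4 / 3 * \<bar>u\<bar> ^ 3 * K / r ^ 3" .
    have "w\<^sup>2 \<le> (2 * \<bar>u\<bar> / (real N * r))\<^sup>2"
      using power_mono[OF w, of 2] by simp
    then have "w\<^sup>2 * v \<le> (2 * \<bar>u\<bar> / (real N * r))\<^sup>2 * ((real N)\<^sup>2 * B ^ 4)"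
      using v0 v1 by (intro mult_mono) auto
    also have "\<dots> = 4 * u\<^sup>2 * B ^ 4 / r\<^sup>2"
      using N r by (simp add: power_divide power_mult_distrib)
    finally have "(w\<^sup>2 * v)\<^sup>2 \<le> (4 * u\<^sup>2 * B ^ 4 / r\<^sup>2)\<^sup>2"
      using v0 by (intro power_mono) auto
    then have "(w\<^sup>2 * v)\<^sup>2 / 8 \<le> 2 * u ^ 4 * B ^ 8 / r ^ 4"
      by (simp add: power_divide power_mult_distrib flip: power_mult)
    \<comment> \<open>As r is at least 1, one power is given up so that both errors share the same
      denominator.\<close>
    also have "\<dots> \<le> 2 * u ^ 4 * B ^ 8 / r ^ 3"
      using r by (intro divide_left_mono power_increasing) (auto simp: zero_le_even_power)
    finally have 2: "(w\<^sup>2 * v)\<^sup>2 / 8 \<le> 2 * u ^ 4 * B ^ 8 / r ^ 3" .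
    have "real T * (\<bar>w\<bar> ^ 3 * (K * real N ^ 3) / 6 + (w\<^sup>2 * v)\<^sup>2 / 8)
      \<le> (r * r) * (4 / 3 * \<bar>u\<bar> ^ 3 * K / r ^ 3 + 2 * u ^ 4 * B ^ 8 / r ^ 3)"
      unfolding r(2) using 1 2 by (intro mult_left_mono add_mono) auto
    also have "\<dots> = (4 / 3 * \<bar>u\<bar> ^ 3 * K + 2 * u ^ 4 * B ^ 8) / r"
    proof -
      have "(r * r) * (x / r ^ 3 + y / r ^ 3) = (x + y) / r" for x y
        using r(1) by (simp add: power3_eq_cube add_divide_distrib[symmetric])
      then show ?thesis .
    qed
    finally show ?thesis .
  qed
  finally show ?thesis by (simp add: w_def r_def)
qed

section \<open>The remainder in mean\<close>

lemma sg_coord_meas [measurable]: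
  "(\<lambda>p. fst p (Inr i)) \<in> borel_measurable (sg_space \<Otimes>\<^sub>M eta_space)"
  by (rule measurable_compose[OF measurable_fst]) (rule measurable_component_singleton, simp)

lemma eta_coord_meas [measurable]:
  "(\<lambda>p. snd p (Inl (i, t))) \<in> borel_measurable (sg_space \<Otimes>\<^sub>M eta_space)"
  by (rule measurable_compose[OF measurable_snd]) (rule measurable_component_singleton, simp)

text \<open>With \<sigma> frozen, the sum has independent centered terms with variances
  w(\<sigma>_k)^2 \<le> W^2; integrating over \<sigma> keeps the bound.\<close>

lemma
  assumes w [measurable]: "w \<in> borel_measurable borel"
    and W: "\<And>i \<omega>. \<omega> \<in> space M \<Longrightarrow> \<bar>w (sg i \<omega>)\<bar> \<le> W"
  shows integrable_weighted_sum_sq: "integrable M (\<lambda>\<omega>. (\<Sum>k<N. w (sg k \<omega>) * eta k t \<omega>)\<^sup>2)"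
    and second_moment_weighted_sum: "expectation (\<lambda>\<omega>. (\<Sum>k<N. w (sg k \<omega>) * eta k t \<omega>)\<^sup>2) \<le> real N * W\<^sup>2"
proof -
  show int: "integrable M (\<lambda>\<omega>. (\<Sum>k<N. w (sg k \<omega>) * eta k t \<omega>)\<^sup>2)"
  \<comment> \<open>A crude domination by Cauchy-Schwarz, used for integrability only; the factor N
    that it loses does not enter the moment bound.\<close>
  proof (rule Bochner_Integration.integrable_bound[of M "\<lambda>\<omega>. (\<Sum>k<N. W\<^sup>2 * (eta k t \<omega>)\<^sup>2) * real N"])
    have "(\<Sum>k<N. w (sg k \<omega>) * eta k t \<omega>)\<^sup>2 \<le> (\<Sum>k<N. W\<^sup>2 * (eta k t \<omega>)\<^sup>2) * real N"
      if "\<omega> \<in> space M" for \<omega>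
    proof -
      have "(\<Sum>k<N. w (sg k \<omega>) * eta k t \<omega>)\<^sup>2 \<le> (\<Sum>k<N. (w (sg k \<omega>) * eta k t \<omega>)\<^sup>2) * card {..<N}"
        by (rule sum_squared_le_sum_of_squares)
      also have "(\<Sum>k<N. (w (sg k \<omega>) * eta k t \<omega>)\<^sup>2) \<le> (\<Sum>k<N. W\<^sup>2 * (eta k t \<omega>)\<^sup>2)"
        unfolding power_mult_distrib using power_mono[OF W[OF that], where n=2]
        by (intro sum_mono mult_right_mono) auto
      finally show ?thesis by (simp add: mult_right_mono)
    qed
    then show "AE \<omega> in M. norm ((\<Sum>k<N. w (sg k \<omega>) * eta k t \<omega>)\<^sup>2) \<le> norm ((\<Sum>k<N. W\<^sup>2 * (eta k t \<omega>)\<^sup>2) * real N)"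
      by (intro AE_I2) (simp add: abs_of_nonneg sum_nonneg)
  qed (use eta_int in auto)
  let ?g = "\<lambda>s e. (\<Sum>k<N. w (s k) * e k t)\<^sup>2 :: real"
  have meas: "(\<lambda>(x, y). ?g (\<lambda>i. x (Inr i)) (\<lambda>i t. y (Inl (i, t)))) \<in> borel_measurable (sg_space \<Otimes>\<^sub>M eta_space)"
    unfolding split_beta' by measurable
  have inner: "(\<integral>\<omega>'. ?g (\<lambda>i. sg i \<omega>) (\<lambda>i t. eta i t \<omega>') \<partial>M) \<le> real N * W\<^sup>2" if "\<omega> \<in> space M" for \<omega>
  proof -
    interpret X: centered_indep_seq M "\<lambda>i \<omega>'. w (sg i \<omega>) * eta i t \<omega>'" "W ^ 6 * m6"
      using W[OF that] by (rule centered_scaled_eta)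
    have "(\<integral>\<omega>'. ?g (\<lambda>i. sg i \<omega>) (\<lambda>i t. eta i t \<omega>') \<partial>M) = (\<Sum>i<N. (w (sg i \<omega>))\<^sup>2)"
      using X.second_moment_S[of N] unfolding X.S_def second_moment_scaled_eta[of "\<lambda>i. w (sg i \<omega>)"] .
    also have "\<dots> \<le> (\<Sum>i<N. W\<^sup>2)"
      using power_mono[OF W[OF that], where n=2] by (intro sum_mono) auto
    finally show ?thesis by simp
  qed
  have "expectation (\<lambda>\<omega>. ?g (\<lambda>i. sg i \<omega>) (\<lambda>i t. eta i t \<omega>))
      = (\<integral>\<omega>. (\<integral>\<omega>'. ?g (\<lambda>i. sg i \<omega>) (\<lambda>i t. eta i t \<omega>') \<partial>M) \<partial>M)"
    by (rule decouple[OF meas int])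
  also have "\<dots> \<le> real N * W\<^sup>2"
    using inner by (intro integral_le_const integrable_decouple[OF meas int]) auto
  finally show "expectation (\<lambda>\<omega>. (\<Sum>k<N. w (sg k \<omega>) * eta k t \<omega>)\<^sup>2) \<le> real N * W\<^sup>2" .
qed

text \<open>Each of the T periods contributes at most K in mean, and the normalization is of order 1
  / (N sqrt T), which together give sqrt T / N.\<close>

lemma
  assumes N: "N \<ge> 2" and T: "T \<ge> 1"
  defines "K \<equiv> (1 + 1 / \<delta>\<^sup>2) * Mb\<^sup>2 + (1 / \<delta>)\<^sup>2"
  shows integrable_remainder: "integrable M (\<lambda>\<omega>. remainder N T (\<lambda>i. sg i \<omega>) (\<lambda>i t. eta i t \<omega>))"
    and mean_abs_remainder_le:
      "expectation (\<lambda>\<omega>. \<bar>remainder N T (\<lambda>i. sg i \<omega>) (\<lambda>i t. eta i t \<omega>)\<bar>) \<le> K * (sqrt (real T) / real N)"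
proof -
  define U where "U t \<omega> = (\<Sum>k<N. sg k \<omega> * eta k t \<omega>)\<^sup>2" for t \<omega>
  define H where "H t \<omega> = (\<Sum>k<N. 1 / sg k \<omega> * eta k t \<omega>)\<^sup>2" for t \<omega>
  have sgb: "\<bar>sg i \<omega>\<bar> \<le> Mb" "\<bar>1 / sg i \<omega>\<bar> \<le> 1 / \<delta>" if "\<omega> \<in> space M" for i \<omega>
    using sigma_bd[OF that, of i] delta_pos frac_le[of 1 1 \<delta> "sg i \<omega>"] by auto
  have U: "integrable M (U t)" "expectation (U t) \<le> real N * Mb\<^sup>2" for t
    unfolding U_def[abs_def]
    using integrable_weighted_sum_sq[of "\<lambda>x. x", OF _ sgb(1)] second_moment_weighted_sum[of "\<lambda>x. x", OF _ sgb(1)] by auto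
  have H: "integrable M (H t)" "expectation (H t) \<le> real N * (1 / \<delta>)\<^sup>2" for t
    unfolding H_def[abs_def]
    by (rule integrable_weighted_sum_sq[of "\<lambda>x. 1 / x", OF _ sgb(2)] second_moment_weighted_sum[of "\<lambda>x. 1 / x", OF _ sgb(2)]; simp)+
  define Z where "Z \<omega> = cd_scale N T / 2 * (\<Sum>t<T. (1 + 1 / \<delta>\<^sup>2) * (U t \<omega> / real N) + H t \<omega> / real N)" for \<omega>
  have Z: "integrable M Z" unfolding Z_def[abs_def] using U H by auto
  have le: "\<bar>remainder N T (\<lambda>i. sg i \<omega>) (\<lambda>i t. eta i t \<omega>)\<bar> \<le> Z \<omega>" if "\<omega> \<in> space M" for \<omega>
    unfolding Z_def U_def H_def using N sigma_bd[OF that] delta_pos by (intro abs_remainder_le) auto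
  have meas: "(\<lambda>\<omega>. remainder N T (\<lambda>i. sg i \<omega>) (\<lambda>i t. eta i t \<omega>)) \<in> borel_measurable M"
    unfolding remainder_def by measurable
  show int: "integrable M (\<lambda>\<omega>. remainder N T (\<lambda>i. sg i \<omega>) (\<lambda>i t. eta i t \<omega>))"
    using le by (intro Bochner_Integration.integrable_bound[OF Z meas] AE_I2) (auto intro: order_trans[OF _ abs_ge_self])
  have "expectation (\<lambda>\<omega>. \<bar>remainder N T (\<lambda>i. sg i \<omega>) (\<lambda>i t. eta i t \<omega>)\<bar>) \<le> expectation Z"
    using int Z le by (intro integral_mono) auto
  also have "\<dots> = cd_scale N T / 2 * (\<Sum>t<T. (1 + 1 / \<delta>\<^sup>2) * (expectation (U t) / real N) + expectation (H t) / real N)"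
    unfolding Z_def[abs_def] using U(1) H(1) by simp
  also have "\<dots> \<le> cd_scale N T / 2 * (\<Sum>t<T. (1 + 1 / \<delta>\<^sup>2) * (real N * Mb\<^sup>2 / real N) + real N * (1 / \<delta>)\<^sup>2 / real N)"
    using U(2) H(2) cd_scale_nonneg
    by (intro mult_left_mono sum_mono add_mono divide_right_mono) auto
  also have "\<dots> = cd_scale N T / 2 * (real T * K)"
    using N by (simp add: K_def)
  also have "\<dots> \<le> (2 / (real N * sqrt (real T))) / 2 * (real T * K)"
    using cd_scale_le[OF N T] by (intro mult_right_mono divide_right_mono) (auto simp: K_def)
  also have "\<dots> = K * (sqrt (real T) / real N)"
  proof -
    have "real T / sqrt (real T) = sqrt (real T)" using T by (simp add: real_div_sqrt)
    then show ?thesis using N T by (simp add: field_simps)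
  qed
  finally show "expectation (\<lambda>\<omega>. \<bar>remainder N T (\<lambda>i. sg i \<omega>) (\<lambda>i t. eta i t \<omega>)\<bar>) \<le> K * (sqrt (real T) / real N)" .
qed

section \<open>Convergence of the conditional variance\<close>

definition kappa :: real where
  "kappa = 1 - 2 * expectation (\<lambda>\<omega>. sg 0 \<omega>) * expectation (\<lambda>\<omega>. 1 / sg 0 \<omega>)
    + expectation (\<lambda>\<omega>. (sg 0 \<omega>)\<^sup>2) * (expectation (\<lambda>\<omega>. 1 / sg 0 \<omega>))\<^sup>2"

lemma weight_meas [measurable]: "(\<lambda>\<omega>. weight N (\<lambda>i. sg i \<omega>) i) \<in> borel_measurable M"
  unfolding weight_def by measurable

lemma abs_weight_sg_le:
  "N \<ge> 1 \<Longrightarrow> \<omega> \<in> space M \<Longrightarrow> \<bar>weight N (\<lambda>i. sg i \<omega>) i\<bar> \<le> 1 + Mb / \<delta>"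
  using sigma_bd delta_pos by (intro abs_weight_le) auto

lemma pair_variance_meas [measurable]:
  "(\<lambda>\<omega>. pair_variance N (weight N (\<lambda>i. sg i \<omega>))) \<in> borel_measurable M"
  unfolding pair_variance_def by measurable

text \<open>\<open>kappa\<close> is the mean of (1 - E[1/\<sigma>] \<sigma>)^2, the limit of the
  mean squared weight G. The conditional variance is close to G^2 by
  \<open>pair_variance_approx\<close>, and G is close to \<open>kappa\<close> because the sample
  means in \<open>mean_weight_sq\<close> are close to expectations.\<close>

lemma pair_variance_concentrates:
  obtains K where "\<And>N. N \<ge> 2 \<Longrightarrow>
      integrable M (\<lambda>\<omega>. pair_variance N (weight N (\<lambda>i. sg i \<omega>)) - kappa\<^sup>2)"
    "\<And>N. N \<ge> 2 \<Longrightarrow>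
      expectation (\<lambda>\<omega>. \<bar>pair_variance N (weight N (\<lambda>i. sg i \<omega>)) - kappa\<^sup>2\<bar>) \<le> K / sqrt (real N)"
proof -
  define B where "B = 1 + Mb / \<delta>"
  define k where "k = 1 / \<delta>"
  have B: "B \<ge> 1" "B = 1 + k * Mb" and k: "k > 0"
    using delta_pos Mb_pos by (auto simp: B_def k_def)
  define dev where "dev W = (4 * W\<^sup>2 + 1) / 2" for W :: real
  define L where "L N g \<omega> = (\<Sum>i<N. g (sg i \<omega>)) / real N" for N \<omega> and g :: "real \<Rightarrow> real"
  define mu where "mu g = expectation (\<lambda>\<omega>. g (sg 0 \<omega>))" for g :: "real \<Rightarrow> real"
  have bds: "\<bar>sg i \<omega>\<bar> \<le> Mb" "\<bar>1 / sg i \<omega>\<bar> \<le> k" "\<bar>(sg i \<omega>)\<^sup>2\<bar> \<le> Mb\<^sup>2" if "\<omega> \<in> space M" for i \<omega>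
    using sigma_bd[OF that, of i] delta_pos frac_le[of 1 1 \<delta> "sg i \<omega>"]
    by (auto simp: k_def intro!: power_mono)
  have L_meas: "L N g \<in> borel_measurable M" if [measurable]: "g \<in> borel_measurable borel" for g N
    unfolding L_def[abs_def] by measurable
  have L_bd: "\<bar>L N g \<omega>\<bar> \<le> W" if "\<omega> \<in> space M" "N > 0" "\<And>i \<omega>. \<omega> \<in> space M \<Longrightarrow> \<bar>g (sg i \<omega>)\<bar> \<le> W" for N g W \<omega>
    unfolding L_def using that by (intro abs_mean_le) auto
  have L_int: "integrable M (\<lambda>\<omega>. \<bar>L N g \<omega> - mu g\<bar>)"
    if "g \<in> borel_measurable borel" "N > 0" "\<And>i \<omega>. \<omega> \<in> space M \<Longrightarrow> \<bar>g (sg i \<omega>)\<bar> \<le> W" for N g W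
  proof -
    have "integrable M (L N g)"
      using L_meas[OF that(1)] L_bd[of _ N g W, OF _ that(2,3)] by (intro integrable_const_bound[of _ W] AE_I2) auto
    then show ?thesis by auto
  qed
  have L_dev: "expectation (\<lambda>\<omega>. \<bar>L N g \<omega> - mu g\<bar>) \<le> dev W / sqrt (real N)"
    if "g \<in> borel_measurable borel" "N > 0" "\<And>i \<omega>. \<omega> \<in> space M \<Longrightarrow> \<bar>g (sg i \<omega>)\<bar> \<le> W" for N g W
    unfolding L_def mu_def dev_def
    using that sg_transfer[OF that(1)] by (intro mean_abs_deviation_le indep_sg) auto
  have mu_bd: "\<bar>mu g\<bar> \<le> W" if [measurable]: "g \<in> borel_measurable borel" and
    W: "\<And>i \<omega>. \<omega> \<in> space M \<Longrightarrow> \<bar>g (sg i \<omega>)\<bar> \<le> W" for g W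
  proof -
    have "\<bar>mu g\<bar> \<le> expectation (\<lambda>\<omega>. \<bar>g (sg 0 \<omega>)\<bar>)" unfolding mu_def by (rule integral_abs_bound)
    also have "\<dots> \<le> W"
      using W by (intro integral_le_const integrable_const_bound[of _ W]) auto
    finally show ?thesis .
  qed
  define c1 where "c1 = 2 * Mb + 2 * k * Mb\<^sup>2"
  \<comment> \<open>A pointwise bound on the deviation: the bracket comes from
    \<open>abs_poly_diff_le\<close>, the factor 2 B^2 is a Lipschitz constant of squaring on the
    interval from -B^2 to B^2, and the last term is the error of
    \<open>pair_variance_approx\<close>.\<close>
  define F where "F N \<omega> = 2 * B\<^sup>2 * (c1 * \<bar>L N (\<lambda>x. 1 / x) \<omega> - mu (\<lambda>x. 1 / x)\<bar>
      + 2 * k * \<bar>L N (\<lambda>x. x) \<omega> - mu (\<lambda>x. x)\<bar> + k\<^sup>2 * \<bar>L N (\<lambda>x. x\<^sup>2) \<omega> - mu (\<lambda>x. x\<^sup>2)\<bar>)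
      + 2 * B ^ 4 / real N" for N \<omega>
  have kappa: "kappa = 1 - 2 * mu (\<lambda>x. 1 / x) * mu (\<lambda>x. x) + (mu (\<lambda>x. 1 / x))\<^sup>2 * mu (\<lambda>x. x\<^sup>2)"
    by (simp add: kappa_def mu_def)
  have kappa_bd: "\<bar>kappa\<bar> \<le> B\<^sup>2"
  proof -
    have m: "\<bar>mu (\<lambda>x. 1 / x)\<bar> \<le> k" "\<bar>mu (\<lambda>x. x)\<bar> \<le> Mb" "\<bar>mu (\<lambda>x. x\<^sup>2)\<bar> \<le> Mb\<^sup>2"
      using bds by (auto intro!: mu_bd)
    have "\<bar>kappa\<bar> \<le> 1 + \<bar>2 * mu (\<lambda>x. 1 / x) * mu (\<lambda>x. x)\<bar> + \<bar>(mu (\<lambda>x. 1 / x))\<^sup>2 * mu (\<lambda>x. x\<^sup>2)\<bar>"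
      unfolding kappa by linarith
    also have "\<dots> \<le> 1 + 2 * k * Mb + k\<^sup>2 * Mb\<^sup>2"
      unfolding abs_mult using m k Mb_pos power_mono[OF m(1), of 2]
      by (intro add_mono mult_mono) auto
    also have "\<dots> = B\<^sup>2" by (simp add: B(2) power2_sum power_mult_distrib)
    finally show ?thesis .
  qed
  have F: "\<bar>pair_variance N (weight N (\<lambda>i. sg i \<omega>)) - kappa\<^sup>2\<bar> \<le> F N \<omega>"
    if N: "N \<ge> 2" and \<omega>: "\<omega> \<in> space M" for N \<omega>
  proof -
    have N0: "N > 0" using N by simp
    let ?b = "weight N (\<lambda>i. sg i \<omega>)"
    define G where "G = (\<Sum>i<N. (?b i)\<^sup>2) / real N"
    have b: "\<bar>?b i\<bar> \<le> B" for i unfolding B_def using N \<omega> by (intro abs_weight_sg_le) auto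
    have G: "\<bar>G\<bar> \<le> B\<^sup>2"
      unfolding G_def using N0 power_mono[OF b, where n=2] by (intro abs_mean_le) auto
    have "\<bar>G - kappa\<bar> \<le> c1 * \<bar>L N (\<lambda>x. 1 / x) \<omega> - mu (\<lambda>x. 1 / x)\<bar>
      + 2 * k * \<bar>L N (\<lambda>x. x) \<omega> - mu (\<lambda>x. x)\<bar> + k\<^sup>2 * \<bar>L N (\<lambda>x. x\<^sup>2) \<omega> - mu (\<lambda>x. x\<^sup>2)\<bar>"
      unfolding G_def mean_weight_sq[OF N0] kappa c1_def
      unfolding L_def[of N _ \<omega>, symmetric, where g="\<lambda>x. 1 / x"] L_def[of N _ \<omega>, symmetric, where g="\<lambda>x. x"]
        L_def[of N _ \<omega>, symmetric, where g="\<lambda>x. x\<^sup>2"]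
      using bds \<omega> N0 by (intro abs_poly_diff_le L_bd mu_bd) auto
    moreover have "\<bar>G\<^sup>2 - kappa\<^sup>2\<bar> \<le> 2 * B\<^sup>2 * \<bar>G - kappa\<bar>"
    proof -
      have "\<bar>G\<^sup>2 - kappa\<^sup>2\<bar> = \<bar>G + kappa\<bar> * \<bar>G - kappa\<bar>"
        by (simp add: power2_eq_square square_diff_square_factored flip: abs_mult)
      also have "\<dots> \<le> 2 * B\<^sup>2 * \<bar>G - kappa\<bar>"
        using G kappa_bd by (intro mult_right_mono) auto
      finally show ?thesis .
    qed
    moreover have "\<bar>pair_variance N ?b - G\<^sup>2\<bar> \<le> 2 * B ^ 4 / real N"
      unfolding G_def using N b by (intro pair_variance_approx) auto
    moreover have "2 * B\<^sup>2 \<ge> 0" by simp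
    ultimately show ?thesis
      unfolding F_def by (smt (verit, best) mult_left_mono)
  qed
  define K where "K = 2 * B\<^sup>2 * (c1 * dev k + 2 * k * dev Mb + k\<^sup>2 * dev (Mb\<^sup>2)) + 2 * B ^ 4"
  have meas: "(\<lambda>x. 1 / x) \<in> borel_measurable (borel :: real measure)"
    "(\<lambda>x. x) \<in> borel_measurable (borel :: real measure)" "(\<lambda>x. x\<^sup>2) \<in> borel_measurable (borel :: real measure)"
    by measurable
  have F_int: "integrable M (F N)" if "N \<ge> 2" for N
    unfolding F_def[abs_def]
    using that L_int[OF meas(1) _ bds(2)] L_int[OF meas(2) _ bds(1)] L_int[OF meas(3) _ bds(3)] by simp
  show thesis
  proof (rule that[of K])
    fix N :: nat assume N: "N \<ge> 2"
    show int: "integrable M (\<lambda>\<omega>. pair_variance N (weight N (\<lambda>i. sg i \<omega>)) - kappa\<^sup>2)"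
      by (rule Bochner_Integration.integrable_bound[OF F_int[OF N]])
         (use F[OF N] in \<open>auto intro!: AE_I2 intro: order_trans[OF _ abs_ge_self]\<close>)
    have "expectation (\<lambda>\<omega>. \<bar>pair_variance N (weight N (\<lambda>i. sg i \<omega>)) - kappa\<^sup>2\<bar>) \<le> expectation (F N)"
      using int F_int[OF N] F[OF N] by (intro integral_mono) auto
    also have "\<dots> = 2 * B\<^sup>2 * (c1 * expectation (\<lambda>\<omega>. \<bar>L N (\<lambda>x. 1 / x) \<omega> - mu (\<lambda>x. 1 / x)\<bar>)
      + 2 * k * expectation (\<lambda>\<omega>. \<bar>L N (\<lambda>x. x) \<omega> - mu (\<lambda>x. x)\<bar>)
      + k\<^sup>2 * expectation (\<lambda>\<omega>. \<bar>L N (\<lambda>x. x\<^sup>2) \<omega> - mu (\<lambda>x. x\<^sup>2)\<bar>)) + 2 * B ^ 4 / real N"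
      unfolding F_def[abs_def]
      using N L_int[OF meas(1) _ bds(2)] L_int[OF meas(2) _ bds(1)] L_int[OF meas(3) _ bds(3)]
      by (simp add: prob_space)
    also have "\<dots> \<le> 2 * B\<^sup>2 * (c1 * (dev k / sqrt (real N)) + 2 * k * (dev Mb / sqrt (real N))
      + k\<^sup>2 * (dev (Mb\<^sup>2) / sqrt (real N))) + 2 * B ^ 4 / sqrt (real N)"
    proof (intro add_mono mult_left_mono L_dev meas bds)
      \<comment> \<open>The 1/N term is weakened to 1 / sqrt N so that all terms share one
        rate.\<close>
      have "sqrt (real N) \<le> sqrt (real N) * sqrt (real N)"
        using N by (intro mult_le_cancel_left1[THEN iffD2]) auto
      then show "2 * B ^ 4 / real N \<le> 2 * B ^ 4 / sqrt (real N)"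
        using N by (intro divide_left_mono) (auto simp: zero_le_even_power)
    qed (use N k Mb_pos in \<open>auto simp: c1_def\<close>)
    also have "\<dots> = K / sqrt (real N)"
      by (simp add: K_def add_divide_distrib distrib_left)
    finally show "expectation (\<lambda>\<omega>. \<bar>pair_variance N (weight N (\<lambda>i. sg i \<omega>)) - kappa\<^sup>2\<bar>) \<le> K / sqrt (real N)" .
  qed
qed

section \<open>Characteristic function of the leading term\<close>

lemma Lead_meas [measurable]: "Lead sg eta N T \<in> borel_measurable M"
  unfolding Lead_def[abs_def] eps_def sbar_inv_def by measurable

text \<open>Given \<sigma>, the characteristic function is close to exp(-u^2 V / 2) with V the
  conditional variance; averaging over \<sigma> and replacing V by its limit gives the two error
  terms. K is fixed before N, T and u.\<close>

lemma char_Lead_approx: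
  obtains K where "\<And>N T u. N \<ge> 2 \<Longrightarrow> T \<ge> 1 \<Longrightarrow>
    cmod (char (distr M borel (Lead sg eta N T)) u - exp (- (u\<^sup>2 * kappa\<^sup>2 / 2)))
      \<le> K * (\<bar>u\<bar> ^ 3 + u ^ 4) / sqrt (real T) + K * u\<^sup>2 / sqrt (real N)"
proof -
  obtain K1 where K1: "\<And>N. N \<ge> 2 \<Longrightarrow>
      integrable M (\<lambda>\<omega>. pair_variance N (weight N (\<lambda>i. sg i \<omega>)) - kappa\<^sup>2)"
    "\<And>N. N \<ge> 2 \<Longrightarrow>
      expectation (\<lambda>\<omega>. \<bar>pair_variance N (weight N (\<lambda>i. sg i \<omega>)) - kappa\<^sup>2\<bar>) \<le> K1 / sqrt (real N)"
    by (rule pair_variance_concentrates) (rule that; blast)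
  define B where "B = 1 + Mb / \<delta>"
  define K2 where "K2 = moment6_const (B ^ 6 * m6) + B ^ 6 * m6"
  define K where "K = max (max (4 / 3 * K2) (2 * B ^ 8)) (K1 / 2)"
  show thesis
  proof (rule that[of K])
    fix N T :: nat and u :: real assume N: "N \<ge> 2" and T: "T \<ge> 1"
    define P where "P s e = (\<Sum>t<T. pairform N (weight N s) (\<lambda>i. e i t))" for s e
    define w where "w = u * cd_scale N T"
    define V where "V \<omega> = pair_variance N (weight N (\<lambda>i. sg i \<omega>))" for \<omega>
    \<comment> \<open>The conditional characteristic function of \<open>Lead\<close> given \<sigma>:
      \<open>u\<close> times \<open>Lead\<close> is \<open>w\<close> times \<open>P\<close>.\<close>
    define \<phi> where "\<phi> \<omega> = (CLINT \<omega>'|M. iexp (w * P (\<lambda>i. sg i \<omega>) (\<lambda>i t. eta i t \<omega>')))" for \<omega>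
    define \<Delta> where "\<Delta> = (4 / 3 * \<bar>u\<bar> ^ 3 * K2 + 2 * u ^ 4 * B ^ 8) / sqrt (real T)"
    have [measurable]: "V \<in> borel_measurable M" unfolding V_def[abs_def] by measurable
    have P_meas: "(\<lambda>p. P (\<lambda>i. fst p (Inr i)) (\<lambda>i t. snd p (Inl (i, t)))) \<in> borel_measurable (sg_space \<Otimes>\<^sub>M eta_space)"
      unfolding P_def pairform_def weight_def by measurable
    have meas: "(\<lambda>(x, y). iexp (w * P (\<lambda>i. x (Inr i)) (\<lambda>i t. y (Inl (i, t))))) \<in> borel_measurable (sg_space \<Otimes>\<^sub>M eta_space)"
      unfolding split_beta' using P_meas by measurable
    have P_meas': "(\<lambda>\<omega>. P (\<lambda>i. sg i \<omega>) (\<lambda>i t. eta i t \<omega>)) \<in> borel_measurable M"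
      unfolding P_def pairform_def weight_def by measurable
    have int: "integrable M (\<lambda>\<omega>. iexp (w * P (\<lambda>i. sg i \<omega>) (\<lambda>i t. eta i t \<omega>)))"
      using P_meas' by (intro integrable_const_bound[of _ 1]) auto
    have \<phi>_int: "integrable M \<phi>"
      unfolding \<phi>_def[abs_def] by (rule integrable_decouple[OF meas int])
    have "char (distr M borel (Lead sg eta N T)) u = (CLINT \<omega>|M. iexp (u * Lead sg eta N T \<omega>))"
      unfolding char_def by (simp add: integral_distr)
    also have "\<dots> = (CLINT \<omega>|M. iexp (w * P (\<lambda>i. sg i \<omega>) (\<lambda>i t. eta i t \<omega>)))"
    proof (rule Bochner_Integration.integral_cong[OF refl])
      fix \<omega> assume "\<omega> \<in> space M"
      then have "sg i \<omega> \<noteq> 0" for i using sigma_bd[of \<omega> i] delta_pos by auto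
      then show "iexp (u * Lead sg eta N T \<omega>) = iexp (w * P (\<lambda>i. sg i \<omega>) (\<lambda>i t. eta i t \<omega>))"
        by (simp add: Lead_eq P_def w_def mult.assoc)
    qed
    also have "\<dots> = (CLINT \<omega>|M. \<phi> \<omega>)"
      unfolding \<phi>_def by (rule decouple[OF meas int])
    finally have char: "char (distr M borel (Lead sg eta N T)) u = (CLINT \<omega>|M. \<phi> \<omega>)" .
    have V0: "0 \<le> V \<omega>" for \<omega> unfolding V_def using N by (intro pair_variance_nonneg) auto
    have pointwise: "cmod (\<phi> \<omega> - exp (- (u\<^sup>2 * kappa\<^sup>2 / 2))) \<le> \<Delta> + u\<^sup>2 / 2 * \<bar>V \<omega> - kappa\<^sup>2\<bar>"
      if \<omega>: "\<omega> \<in> space M" for \<omega>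
    proof -
      have \<phi>: "\<phi> \<omega> = char (distr M borel (\<lambda>\<omega>'. \<Sum>t<T. pairform N (weight N (\<lambda>i. sg i \<omega>)) (\<lambda>i. eta i t \<omega>'))) (u * cd_scale N T)"
      proof -
        have "(\<lambda>\<omega>'. \<Sum>t<T. pairform N (weight N (\<lambda>i. sg i \<omega>)) (\<lambda>i. eta i t \<omega>')) \<in> borel_measurable M"
          unfolding pairform_def by measurable
        then show ?thesis unfolding char_def \<phi>_def w_def P_def by (subst integral_distr) auto
      qed
      have "cmod (\<phi> \<omega> - exp (- (u\<^sup>2 * V \<omega> / 2))) \<le> \<Delta>"
        unfolding \<phi> V_def \<Delta>_def K2_def B_def
        using N T \<omega> by (intro char_pairform_approx abs_weight_sg_le) auto
      moreover have "cmod (complex_of_real (exp (- (u\<^sup>2 * V \<omega> / 2))) - exp (- (u\<^sup>2 * kappa\<^sup>2 / 2))) \<le> u\<^sup>2 / 2 * \<bar>V \<omega> - kappa\<^sup>2\<bar>"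
      proof -
        have "\<bar>exp (- (u\<^sup>2 * V \<omega> / 2)) - exp (- (u\<^sup>2 * kappa\<^sup>2 / 2))\<bar> \<le> \<bar>u\<^sup>2 * V \<omega> / 2 - u\<^sup>2 * kappa\<^sup>2 / 2\<bar>"
          using V0[of \<omega>] by (intro abs_exp_minus_diff_le) auto
        also have "u\<^sup>2 * V \<omega> / 2 - u\<^sup>2 * kappa\<^sup>2 / 2 = u\<^sup>2 / 2 * (V \<omega> - kappa\<^sup>2)"
          by (simp add: field_simps)
        finally show ?thesis
          by (simp add: abs_mult flip: of_real_diff)
      qed
      ultimately show ?thesis
        using norm_triangle_ineq[of "\<phi> \<omega> - exp (- (u\<^sup>2 * V \<omega> / 2))"
            "complex_of_real (exp (- (u\<^sup>2 * V \<omega> / 2))) - exp (- (u\<^sup>2 * kappa\<^sup>2 / 2))"] by simp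
    qed
    have V_int: "integrable M (\<lambda>\<omega>. V \<omega> - kappa\<^sup>2)" unfolding V_def by (rule K1(1)[OF N])
    have "(CLINT \<omega>|M. \<phi> \<omega>) - exp (- (u\<^sup>2 * kappa\<^sup>2 / 2)) = (CLINT \<omega>|M. \<phi> \<omega> - exp (- (u\<^sup>2 * kappa\<^sup>2 / 2)))"
      using \<phi>_int by (simp add: prob_space)
    also have "cmod \<dots> \<le> expectation (\<lambda>\<omega>. cmod (\<phi> \<omega> - exp (- (u\<^sup>2 * kappa\<^sup>2 / 2))))"
      by (rule integral_norm_bound)
    also have "\<dots> \<le> expectation (\<lambda>\<omega>. \<Delta> + u\<^sup>2 / 2 * \<bar>V \<omega> - kappa\<^sup>2\<bar>)"
      using \<phi>_int V_int pointwise by (intro integral_mono) auto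
    also have "\<dots> = \<Delta> + u\<^sup>2 / 2 * expectation (\<lambda>\<omega>. \<bar>V \<omega> - kappa\<^sup>2\<bar>)"
      using V_int by (simp add: prob_space)
    also have "\<dots> \<le> \<Delta> + u\<^sup>2 / 2 * (K1 / sqrt (real N))"
      unfolding V_def using K1(2)[OF N] by (intro add_left_mono mult_left_mono) auto
    also have "\<dots> \<le> K * (\<bar>u\<bar> ^ 3 + u ^ 4) / sqrt (real T) + K * u\<^sup>2 / sqrt (real N)"
    proof (rule add_mono)
      have "4 / 3 * K2 * \<bar>u\<bar> ^ 3 \<le> K * \<bar>u\<bar> ^ 3" "2 * B ^ 8 * u ^ 4 \<le> K * u ^ 4"
        by (intro mult_right_mono; simp add: K_def zero_le_even_power)+
      then show "\<Delta> \<le> K * (\<bar>u\<bar> ^ 3 + u ^ 4) / sqrt (real T)"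
        unfolding \<Delta>_def by (intro divide_right_mono) (auto simp: algebra_simps)
      have "K1 / 2 * u\<^sup>2 \<le> K * u\<^sup>2"
        by (intro mult_right_mono) (auto simp: K_def)
      then have "K1 / 2 * u\<^sup>2 / sqrt (real N) \<le> K * u\<^sup>2 / sqrt (real N)"
        by (intro divide_right_mono) auto
      then show "u\<^sup>2 / 2 * (K1 / sqrt (real N)) \<le> K * u\<^sup>2 / sqrt (real N)"
        by (simp add: mult.commute)
    qed
    finally show "cmod (char (distr M borel (Lead sg eta N T)) u - exp (- (u\<^sup>2 * kappa\<^sup>2 / 2)))
      \<le> K * (\<bar>u\<bar> ^ 3 + u ^ 4) / sqrt (real T) + K * u\<^sup>2 / sqrt (real N)"
      unfolding char .
  qed
qed

section \<open>Stochastic order of the remainder and the limit law\<close>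

lemma CD_minus_bias:
  assumes "N \<ge> 2" "T \<ge> 1" "\<omega> \<in> space M"
  shows "CD tau sg eta N T \<omega> - sqrt (real T) * Xi sg eta N T \<omega>
    = Lead sg eta N T \<omega> + remainder N T (\<lambda>i. sg i \<omega>) (\<lambda>i t. eta i t \<omega>)"
proof -
  have "sg i \<omega> \<noteq> 0" for i using sigma_bd[OF assms(3), of i] delta_pos by auto
  then show ?thesis using CD_decomposition[of N sg \<omega> T tau eta] assms by simp
qed

lemma bigOP_CD_remainder:
  "bigOP M (\<lambda>N T \<omega>. CD tau sg eta N T \<omega> - Lead sg eta N T \<omega> - sqrt (real T) * Xi sg eta N T \<omega>)
     (\<lambda>N T. sqrt (real T) / real N)"
  unfolding bigOP_def
proof (intro allI impI)
  fix e :: real assume e: "e > 0"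
  define K where "K = (1 + 1 / \<delta>\<^sup>2) * Mb\<^sup>2 + (1 / \<delta>)\<^sup>2"
  have K: "K > 0" using delta_pos by (auto simp: K_def intro!: add_nonneg_pos)
  \<comment> \<open>The constant K / e makes Markov's inequality return exactly e.\<close>
  have tail: "prob {\<omega> \<in> space M. \<bar>CD tau sg eta N T \<omega> - Lead sg eta N T \<omega> - sqrt (real T) * Xi sg eta N T \<omega>\<bar>
      > K / e * (sqrt (real T) / real N)} \<le> e" if N: "N \<ge> 2" and T: "T \<ge> 1" for N T
  proof -
    let ?R = "\<lambda>\<omega>. remainder N T (\<lambda>i. sg i \<omega>) (\<lambda>i t. eta i t \<omega>)"
    define c where "c = K / e * (sqrt (real T) / real N)"
    have c: "c > 0" using K e N T by (simp add: c_def)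
    note int = integrable_remainder[OF N T]
    have "prob {\<omega> \<in> space M. \<bar>CD tau sg eta N T \<omega> - Lead sg eta N T \<omega> - sqrt (real T) * Xi sg eta N T \<omega>\<bar> > c}
      \<le> prob {\<omega> \<in> space M. \<bar>?R \<omega>\<bar> \<ge> c}"
    proof (rule finite_measure_mono)
      show "{\<omega> \<in> space M. \<bar>CD tau sg eta N T \<omega> - Lead sg eta N T \<omega> - sqrt (real T) * Xi sg eta N T \<omega>\<bar> > c}
          \<subseteq> {\<omega> \<in> space M. \<bar>?R \<omega>\<bar> \<ge> c}"
      proof safe
        fix \<omega> assume \<omega>: "\<omega> \<in> space M"
          and gt: "c < \<bar>CD tau sg eta N T \<omega> - Lead sg eta N T \<omega> - sqrt (real T) * Xi sg eta N T \<omega>\<bar>"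
        have "CD tau sg eta N T \<omega> - Lead sg eta N T \<omega> - sqrt (real T) * Xi sg eta N T \<omega> = ?R \<omega>"
          using CD_minus_bias[OF N T \<omega>, of tau] by linarith
        with gt show "c \<le> \<bar>?R \<omega>\<bar>" by simp
      qed
      show "{\<omega> \<in> space M. \<bar>?R \<omega>\<bar> \<ge> c} \<in> events"
        using borel_measurable_integrable[OF int] by measurable
    qed
    also have "\<dots> \<le> expectation (\<lambda>\<omega>. \<bar>?R \<omega>\<bar>) / c"
      by (rule integral_Markov_inequality_measure[where A="{}"]) (use int c in auto)
    also have "\<dots> \<le> K * (sqrt (real T) / real N) / c"
      using mean_abs_remainder_le[OF N T] c by (intro divide_right_mono) (auto simp: K_def)
    also have "\<dots> = e" using K e N T by (simp add: c_def)
    finally show ?thesis by (simp add: c_def)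
  qed
  have "\<forall>\<^sub>F p in at_top \<times>\<^sub>F at_top. fst p \<ge> (2::nat) \<and> snd p \<ge> (1::nat)"
    by (rule eventually_prodI[OF eventually_ge_at_top eventually_ge_at_top])
  then have "\<forall>\<^sub>F (N, T) in at_top \<times>\<^sub>F at_top.
      prob {\<omega> \<in> space M. K / e * (sqrt (real T) / real N)
        < \<bar>CD tau sg eta N T \<omega> - Lead sg eta N T \<omega> - sqrt (real T) * Xi sg eta N T \<omega>\<bar>} \<le> e"
    by (rule eventually_mono) (use tail in auto)
  then show "\<exists>C>0. \<forall>\<^sub>F (N, T) in at_top \<times>\<^sub>F at_top.
      prob {\<omega> \<in> space M. C * (sqrt (real T) / real N)
        < \<bar>CD tau sg eta N T \<omega> - Lead sg eta N T \<omega> - sqrt (real T) * Xi sg eta N T \<omega>\<bar>} \<le> e"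
    using K e by (intro exI[of _ "K / e"]) simp
qed

lemma CD_minus_bias_meas [measurable]:
  "(\<lambda>\<omega>. CD tau sg eta N T \<omega> - sqrt (real T) * Xi sg eta N T \<omega>) \<in> borel_measurable M"
  unfolding CD_def Xi_def resid_def tauhat_def yobs_def eps_def sbar_inv_def by measurable

text \<open>The joint limit is tested along arbitrary sequences of pairs (N, T). By Levy's theorem
  pointwise convergence of characteristic functions suffices, and the error splits into the
  remainder in mean and the Gaussian approximation of \<open>Lead\<close>.\<close>

lemma weak_conv_CD:
  assumes Nk: "filterlim Nk at_top sequentially" and Tk: "filterlim Tk at_top sequentially"
    and ratio: "(\<lambda>k. sqrt (real (Tk k)) / real (Nk k)) \<longlonglongrightarrow> 0"
  shows "weak_conv_m
      (\<lambda>k. distr M borel (\<lambda>\<omega>. CD tau sg eta (Nk k) (Tk k) \<omega> - sqrt (real (Tk k)) * Xi sg eta (Nk k) (Tk k) \<omega>))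
      (normal_law (kappa\<^sup>2))"
proof (rule levy_continuity)
  show "real_distribution (distr M borel (\<lambda>\<omega>. CD tau sg eta (Nk k) (Tk k) \<omega>
      - sqrt (real (Tk k)) * Xi sg eta (Nk k) (Tk k) \<omega>))" for k
    by (rule real_distribution_distr) measurable
  show "real_distribution (normal_law (kappa\<^sup>2))" by (rule real_distribution_normal_law)
next
  fix u :: real
  define Y where "Y k \<omega> = CD tau sg eta (Nk k) (Tk k) \<omega> - sqrt (real (Tk k)) * Xi sg eta (Nk k) (Tk k) \<omega>" for k \<omega>
  obtain K where K: "\<And>N T u. N \<ge> 2 \<Longrightarrow> T \<ge> 1 \<Longrightarrow>
    cmod (char (distr M borel (Lead sg eta N T)) u - exp (- (u\<^sup>2 * kappa\<^sup>2 / 2)))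
      \<le> K * (\<bar>u\<bar> ^ 3 + u ^ 4) / sqrt (real T) + K * u\<^sup>2 / sqrt (real N)"
    by (rule char_Lead_approx) (rule that; blast)
  define K' where "K' = (1 + 1 / \<delta>\<^sup>2) * Mb\<^sup>2 + (1 / \<delta>)\<^sup>2"
  \<comment> \<open>The first summand is where the restriction sqrt T / N to 0 enters; the other two
    vanish because T and N each tend to infinity.\<close>
  define bound where "bound k = \<bar>u\<bar> * (K' * (sqrt (real (Tk k)) / real (Nk k)))
      + (K * (\<bar>u\<bar> ^ 3 + u ^ 4) / sqrt (real (Tk k)) + K * u\<^sup>2 / sqrt (real (Nk k)))" for k
  have bound: "cmod (char (distr M borel (Y k)) u - char (normal_law (kappa\<^sup>2)) u) \<le> bound k"
    if N: "Nk k \<ge> 2" and T: "Tk k \<ge> 1" for k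
  proof -
    let ?R = "\<lambda>\<omega>. remainder (Nk k) (Tk k) (\<lambda>i. sg i \<omega>) (\<lambda>i t. eta i t \<omega>)"
    have eq: "Y k \<omega> - Lead sg eta (Nk k) (Tk k) \<omega> = ?R \<omega>" if "\<omega> \<in> space M" for \<omega>
      using CD_minus_bias[OF N T that] by (simp add: Y_def)
    have "cmod (char (distr M borel (Y k)) u - char (distr M borel (Lead sg eta (Nk k) (Tk k))) u)
        \<le> \<bar>u\<bar> * expectation (\<lambda>\<omega>. \<bar>Y k \<omega> - Lead sg eta (Nk k) (Tk k) \<omega>\<bar>)"
    proof (rule char_distr_diff_le)
      show "Y k \<in> borel_measurable M" unfolding Y_def[abs_def] by measurable
      show "integrable M (\<lambda>\<omega>. Y k \<omega> - Lead sg eta (Nk k) (Tk k) \<omega>)"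
        using integrable_remainder[OF N T] eq by (subst Bochner_Integration.integrable_cong[OF refl, of _ _ ?R]) auto
    qed measurable
    also have "expectation (\<lambda>\<omega>. \<bar>Y k \<omega> - Lead sg eta (Nk k) (Tk k) \<omega>\<bar>) = expectation (\<lambda>\<omega>. \<bar>?R \<omega>\<bar>)"
      using eq by (intro Bochner_Integration.integral_cong) auto
    also have "\<bar>u\<bar> * \<dots> \<le> \<bar>u\<bar> * (K' * (sqrt (real (Tk k)) / real (Nk k)))"
      using mean_abs_remainder_le[OF N T] unfolding K'_def by (intro mult_left_mono) auto
    finally have 1: "cmod (char (distr M borel (Y k)) u - char (distr M borel (Lead sg eta (Nk k) (Tk k))) u)
        \<le> \<bar>u\<bar> * (K' * (sqrt (real (Tk k)) / real (Nk k)))" .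
    show ?thesis
      using norm_triangle_mono[OF 1 K[OF N T, of u]]
      unfolding bound_def by (simp add: char_normal_law)
  qed
  have inv_sqrt: "(\<lambda>k. c / sqrt (real (a k))) \<longlonglongrightarrow> 0" if "filterlim a at_top sequentially" for c and a :: "nat \<Rightarrow> nat"
    by (intro real_tendsto_divide_at_top[OF tendsto_const] filterlim_compose[OF sqrt_at_top]
        filterlim_compose[OF filterlim_real_sequentially] that)
  have "(\<lambda>k. \<bar>u\<bar> * (K' * (sqrt (real (Tk k)) / real (Nk k)))) \<longlonglongrightarrow> 0"
    by (intro tendsto_mult_right_zero ratio)
  then have "bound \<longlonglongrightarrow> 0"
    unfolding bound_def[abs_def] by (intro tendsto_add_zero inv_sqrt Nk Tk)
  moreover have "\<forall>\<^sub>F k in sequentially. cmod (char (distr M borel (Y k)) u - char (normal_law (kappa\<^sup>2)) u) \<le> bound k"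
  proof -
    have "\<forall>\<^sub>F k in sequentially. 2 \<le> Nk k" "\<forall>\<^sub>F k in sequentially. 1 \<le> Tk k"
      using Nk Tk by (simp_all add: filterlim_at_top)
    then show ?thesis by eventually_elim (rule bound)
  qed
  ultimately have "(\<lambda>k. char (distr M borel (Y k)) u - char (normal_law (kappa\<^sup>2)) u) \<longlonglongrightarrow> 0"
    by (rule Lim_null_comparison[rotated])
  then show "(\<lambda>k. char (distr M borel (\<lambda>\<omega>. CD tau sg eta (Nk k) (Tk k) \<omega>
      - sqrt (real (Tk k)) * Xi sg eta (Nk k) (Tk k) \<omega>)) u) \<longlonglongrightarrow> char (normal_law (kappa\<^sup>2)) u"
    unfolding Y_def[abs_def] by (simp add: LIM_zero_iff)
qed

end

theorem theorem1:
  fixes M :: "'a measure"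
    and eta :: "nat \<Rightarrow> nat \<Rightarrow> 'a \<Rightarrow> real"
    and sg :: "nat \<Rightarrow> 'a \<Rightarrow> real"
    and tau :: "nat \<Rightarrow> real"
    and \<delta> Mb :: real
  assumes "prob_space M"
    and indep: "prob_space.indep_vars M (\<lambda>_. borel)
                  (\<lambda>k. case k of Inl (i, t) \<Rightarrow> eta i t | Inr i \<Rightarrow> sg i) UNIV"
    and eta_id: "\<And>i t. distr M borel (eta i t) = distr M borel (eta 0 0)"
    and sigma_id: "\<And>i. distr M borel (sg i) = distr M borel (sg 0)"
    and eta_int8: "integrable M (\<lambda>\<omega>. (eta 0 0 \<omega>) ^ 8)"
    and eta_mean: "(\<integral>\<omega>. eta 0 0 \<omega> \<partial>M) = 0"
    and eta_var: "(\<integral>\<omega>. (eta 0 0 \<omega>)\<^sup>2 \<partial>M) = 1"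
    and eta_8: "(\<integral>\<omega>. (eta 0 0 \<omega>) ^ 8 \<partial>M) < Mb"
    and delta_pos: "0 < \<delta>" and "\<delta> < Mb"
    and sigma_bd: "\<And>i \<omega>. \<omega> \<in> space M \<Longrightarrow> \<delta> \<le> sg i \<omega> \<and> sg i \<omega> \<le> Mb"
  shows "bigOP M
           (\<lambda>N T \<omega>. CD tau sg eta N T \<omega> - Lead sg eta N T \<omega>
                      - sqrt (real T) * Xi sg eta N T \<omega>)
           (\<lambda>N T. sqrt (real T) / real N)
       \<and> (\<forall>Nk Tk :: nat \<Rightarrow> nat.
            filterlim Nk at_top sequentially \<longrightarrow> filterlim Tk at_top sequentially \<longrightarrow>
            (\<lambda>k. sqrt (real (Tk k)) / real (Nk k)) \<longlonglongrightarrow> 0 \<longrightarrow>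
            weak_conv_m
              (\<lambda>k. distr M borel (\<lambda>\<omega>. CD tau sg eta (Nk k) (Tk k) \<omega>
                                          - sqrt (real (Tk k)) * Xi sg eta (Nk k) (Tk k) \<omega>))
              (normal_law
                 ((1 - 2 * (\<integral>\<omega>. sg 0 \<omega> \<partial>M) * (\<integral>\<omega>. 1 / sg 0 \<omega> \<partial>M)
                   + (\<integral>\<omega>. (sg 0 \<omega>)\<^sup>2 \<partial>M) * (\<integral>\<omega>. 1 / sg 0 \<omega> \<partial>M)\<^sup>2)\<^sup>2)))"
  proof -
  interpret prob_space M by fact
  have [measurable]: "eta 0 0 \<in> borel_measurable M"
    using indep by (auto simp: indep_vars_def split: sum.splits prod.splits)
  \<comment> \<open>The eighth moment dominates the sixth through |x|^6 \<le> 1 + |x|^8.\<close>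
  have int6: "integrable M (\<lambda>\<omega>. (eta 0 0 \<omega>) ^ 6)"
    by (rule integrable_power_le[OF _ eta_int8[THEN integrable_abs, unfolded power_abs]]) auto
  interpret panel M eta sg \<delta> Mb
    by standard (use indep eta_id sigma_id int6 eta_mean eta_var delta_pos sigma_bd in auto)
  show ?thesis
    using bigOP_CD_remainder weak_conv_CD unfolding kappa_def by blast
qed

end
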